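(* For every integer $n\ge 5$, $$15^{n/5}\le T(n)\le c^n\sqrt{n}\,n!,$$ where $c=\sqrt{\frac{3-\sqrt3}{6}}\,e^{\sqrt3/6}\approx 0.61354$.
   Context: A latin square of order $n$ is an $n\times n$ array of $n$ symbols in which each symbol occurs exactly once in each row and column. A transversal is a set of $n$ cells, one from each row and one from each column, no two containing the same symbol. $T(n)$ denotes the maximum, over all latin squares of order $n$, of the number of transversals of the square. *)

theory Defs
  imports Complex_Main
begin

definition latin_square :: "nat \<Rightarrow> (nat \<Rightarrow> nat \<Rightarrow> nat) \<Rightarrow> bool" where
  "latin_square n L \<longleftrightarrow>
     (\<forall>i<n. bij_betw (\<lambda>j. L i j) {..<n} {..<n}) \<and>
     (\<forall>j<n. bij_betw (\<lambda>i. L i j) {..<n} {..<n})"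

definition transversal :: "nat \<Rightarrow> (nat \<Rightarrow> nat \<Rightarrow> nat) \<Rightarrow> (nat \<times> nat) set \<Rightarrow> bool" where
  "transversal n L S \<longleftrightarrow>
     S \<subseteq> {..<n} \<times> {..<n} \<and>
     (\<forall>i<n. \<exists>!j. (i, j) \<in> S) \<and>
     (\<forall>j<n. \<exists>!i. (i, j) \<in> S) \<and>
     inj_on (\<lambda>(i, j). L i j) S"

definition transversals :: "nat \<Rightarrow> (nat \<Rightarrow> nat \<Rightarrow> nat) \<Rightarrow> (nat \<times> nat) set set" where
  "transversals n L = {S. transversal n L S}"

definition T :: "nat \<Rightarrow> nat" where
  "T n = Max {card (transversals n L) | L. latin_square n L}"

end

theory Submission
  imports Defs "HOL-Combinatorics.Permutations" "HOL-Number_Theory.Cong"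
begin

text \<open>
  Upper bound. Fix an order of the rows and choose the cells of a transversal \<open>f\<close> row by row uniformly
  among the cells that still extend to a transversal; \<open>f\<close> is reached with probability \<open>\<Prod> 1 / N\<^sub>k\<close>, so
  these products sum to at most 1 over all \<open>f\<close>. For a random order of the rows, with \<open>m\<close> rows left after
  the current one, the mean of \<open>N\<^sub>k\<close> is at most \<open>1 + m (m - 1) / (n - 2)\<close>: the row owning a given column and
  the row owning the symbol found there must both come later. Convexity then bounds the number of
  transversals by \<open>\<Prod>m<n. 1 + m (m - 1) / (n - 2)\<close>, which is below the claimed bound for \<open>n \<ge> 6\<close>. For
  \<open>n = 5\<close> a transversal is determined by its cells in the first two rows.

  Lower bound. If \<open>m\<close> is odd and \<open>t \<le> 2 m\<close>, there is a square of order \<open>3 m + t\<close> whose main diagonal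
  carries three blocks of order \<open>m\<close> and one of order \<open>t\<close>, all of them arbitrary subsquares: prolong a
  \<open>3 \<times> 3\<close> array of blocks along \<open>t\<close> disjoint transversals of the off-diagonal blocks. Hence
  \<open>T (3 m + t) \<ge> (T m)\<^sup>3 T t\<close>, and \<open>15\<^sup>n \<le> (T n)\<^sup>5\<close> follows by induction from the cases \<open>5 \<le> n \<le> 19\<close>.
\<close>

section \<open>Transversals as permutations\<close>

lemma latin_square_iff:
  "latin_square n L \<longleftrightarrow>
     (\<forall>i<n. \<forall>j<n. L i j < n) \<and>
     (\<forall>i<n. inj_on (L i) {..<n}) \<and> (\<forall>j<n. inj_on (\<lambda>i. L i j) {..<n})"
    (is "_ \<longleftrightarrow> ?R")
proof
  assume "latin_square n L"
  then show ?R unfolding latin_square_def bij_betw_def by (auto simp: eta_contract_eq)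
next
  assume R: ?R
  have "bij_betw f {..<n} {..<n}" if "inj_on f {..<n}" "\<forall>j<n. f j < n" for f :: "nat \<Rightarrow> nat"
    unfolding bij_betw_def using that endo_inj_surj[of "{..<n}" f] by auto
  with R show "latin_square n L" unfolding latin_square_def by simp
qed

lemma latin_square_row_inject:
  "latin_square n L \<Longrightarrow> i < n \<Longrightarrow> j < n \<Longrightarrow> j' < n \<Longrightarrow> L i j = L i j' \<longleftrightarrow> j = j'"
  unfolding latin_square_iff by (auto dest: inj_onD[where x = j and y = j'])

lemma latin_square_column_inject:
  "latin_square n L \<Longrightarrow> i < n \<Longrightarrow> i' < n \<Longrightarrow> j < n \<Longrightarrow> L i j = L i' j \<longleftrightarrow> i = i'"
  unfolding latin_square_iff by (auto dest: inj_onD[where x = i and y = i'])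

lemma latin_square_less: "latin_square n L \<Longrightarrow> i < n \<Longrightarrow> j < n \<Longrightarrow> L i j < n"
  unfolding latin_square_iff by blast

text \<open>A transversal becomes a total function from rows to columns. \<open>permutes\<close>
  fixes it as the identity outside \<open>{..<n}\<close>, so equality of functions is equality of
  transversals and the set is finite.\<close>

definition tperms :: "nat \<Rightarrow> (nat \<Rightarrow> nat \<Rightarrow> nat) \<Rightarrow> (nat \<Rightarrow> nat) set" where
  "tperms n L = {p. p permutes {..<n} \<and> inj_on (\<lambda>i. L i (p i)) {..<n}}"

lemma finite_tperms [simp]: "finite (tperms n L)"
  unfolding tperms_def by (rule finite_subset[OF _ finite_permutations[of "{..<n}"]]) auto

lemma card_transversals: "card (transversals n L) = card (tperms n L)"
proof -
  define g where "g p = (\<lambda>i. (i, p i)) ` {..<n}" for p :: "nat \<Rightarrow> nat"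
  have "bij_betw g (tperms n L) (transversals n L)"
    unfolding bij_betw_def
  proof
    show "inj_on g (tperms n L)"
    proof
      fix p q assume "p \<in> tperms n L" "q \<in> tperms n L" "g p = g q"
      then have "p permutes {..<n}" "q permutes {..<n}" "\<And>i. i < n \<Longrightarrow> p i = q i"
        unfolding g_def tperms_def by auto
      then show "p = q" by (metis ext lessThan_iff permutes_not_in)
    qed
    show "g ` tperms n L = transversals n L"
    proof (intro equalityI subsetI)
      fix S assume "S \<in> g ` tperms n L"
      then obtain p where p: "p permutes {..<n}" "inj_on (\<lambda>i. L i (p i)) {..<n}" "S = g p"
        unfolding tperms_def by auto
      have "\<exists>!i. (i, j) \<in> S" if "j < n" for j
      proof -
        have "j \<in> p ` {..<n}" using that permutes_image[OF p(1)] by simp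
        then obtain i where "i < n" "p i = j" by auto
        moreover have "inj p" using p(1) by (rule permutes_inj)
        ultimately show ?thesis unfolding p g_def
          by (intro ex1I[of _ i]) (auto dest: injD)
      qed
      moreover have "p i < n" if "i < n" for i
        using that permutes_in_image[OF p(1)] by simp
      ultimately show "S \<in> transversals n L"
        using p(2) unfolding transversals_def transversal_def p(3)
        by (auto simp: g_def inj_on_def)
    next
      fix S assume "S \<in> transversals n L"
      then have S: "S \<subseteq> {..<n} \<times> {..<n}" "\<And>i. i < n \<Longrightarrow> \<exists>!j. (i, j) \<in> S"
        "\<And>j. j < n \<Longrightarrow> \<exists>!i. (i, j) \<in> S" "inj_on (\<lambda>(i, j). L i j) S"
        unfolding transversals_def transversal_def by auto
      define p where "p i = (if i < n then THE j. (i, j) \<in> S else i)" for i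
      have p: "(i, j) \<in> S \<longleftrightarrow> p i = j" if "i < n" for i j
        using theI'[OF S(2)[OF that]] S(2)[OF that] that unfolding p_def by auto
      have pn: "p i < n" if "i < n" for i using p[OF that, of "p i"] S(1) by auto
      have "inj_on p {..<n}"
        using S(3) p pn by (intro inj_onI) (metis lessThan_iff)
      moreover have "p ` {..<n} = {..<n}"
        using calculation pn by (intro endo_inj_surj) auto
      ultimately have "p permutes {..<n}"
        by (intro bij_imp_permutes) (auto simp: bij_betw_def p_def)
      moreover have Sg: "S = g p" using p S(1) unfolding g_def by (auto simp: image_iff)
      moreover have "inj_on (\<lambda>i. L i (p i)) {..<n}"
        using S(4) unfolding Sg g_def by (auto simp: inj_on_def)
      ultimately show "S \<in> g ` tperms n L" unfolding tperms_def by auto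
    qed
  qed
  then show ?thesis by (simp add: bij_betw_same_card)
qed

section \<open>The cyclic square and the maximum over all squares\<close>

abbreviation cyclic :: "nat \<Rightarrow> nat \<Rightarrow> nat \<Rightarrow> nat" where
  "cyclic n i j \<equiv> (i + j) mod n"

lemma inj_on_add_mod: "inj_on (\<lambda>j. (i + j) mod n) {..<n :: nat}"
  by (intro inj_onI) (metis cong_add_lcancel_nat cong_def lessThan_iff mod_less)

lemma latin_square_cyclic: "latin_square n (cyclic n)"
proof -
  have "inj_on (\<lambda>i. cyclic n i j) {..<n}" for j
    using inj_on_add_mod[of j n] by (simp add: add.commute)
  then show ?thesis
    by (cases "n = 0") (auto simp: latin_square_iff inj_on_add_mod)
qed

lemma card_tperms_le_fact: "card (tperms n L) \<le> fact n"
  unfolding tperms_def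
  by (rule order_trans[OF card_mono[of "{p. p permutes {..<n}}"]])
     (auto simp: finite_permutations card_permutations)

text \<open>There are infinitely many functions \<open>L\<close>, since their values outside the
  square are arbitrary, but the counts are at most \<open>fact n\<close>. This finiteness gives
  \<open>Max\<close> its meaning.\<close>

lemma finite_T: "finite {card (transversals n L) | L. latin_square n L}"
  by (rule finite_subset[of _ "{..fact n}"]) (auto simp: card_transversals card_tperms_le_fact)

lemma T_ge: "latin_square n L \<Longrightarrow> card (tperms n L) \<le> T n"
  unfolding T_def using finite_T by (intro Max_ge) (auto simp: card_transversals)

lemma T_attained: "\<exists>L. latin_square n L \<and> T n = card (tperms n L)"
proof -
  have "T n \<in> {card (transversals n L) | L. latin_square n L}"
    unfolding T_def using latin_square_cyclic by (intro Max_in finite_T) blast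
  then show ?thesis by (auto simp: card_transversals)
qed

section \<open>The upper bound\<close>

text \<open>The product is the probability of reaching \<open>f\<close> when the values at
  \<open>xs\<close> are drawn one after the other, uniformly among those still extendable within
  \<open>A\<close>. The induction splits \<open>A\<close> by the value at the first position: each
  of the \<open>card V\<close> classes contributes at most \<open>1 / card V\<close>.\<close>

lemma sum_inverse_choices_le_1:
  fixes xs :: "nat list" and A :: "(nat \<Rightarrow> nat) set"
  assumes "finite A"
    and "\<And>f g. f \<in> A \<Longrightarrow> g \<in> A \<Longrightarrow> \<forall>i\<in>set xs. f i = g i \<Longrightarrow> f = g"
  shows "(\<Sum>f\<in>A. \<Prod>k<length xs.
      1 / real (card ((\<lambda>g. g (xs ! k)) ` {g \<in> A. \<forall>l<k. g (xs ! l) = f (xs ! l)}))) \<le> 1"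
  using assms
proof (induction xs arbitrary: A)
  case Nil
  then have "card A \<le> Suc 0" by (intro card_le_Suc0_iff_eq[THEN iffD2]) auto
  then show ?case by simp
next
  case (Cons i xs)
  define V where "V = (\<lambda>g. g i) ` A"
  define w where "w B f = (\<Prod>k<length xs.
      1 / real (card ((\<lambda>g. g (xs ! k)) ` {g \<in> B. \<forall>l<k. g (xs ! l) = f (xs ! l)})))"
    for B and f :: "nat \<Rightarrow> nat"
  \<comment> \<open>The factor for \<open>k = 0\<close> is \<open>1 / card V\<close>. All later
    factors only see the members of \<open>A\<close> that agree with \<open>f\<close> at
    \<open>i\<close>.\<close>
  have w: "(\<Prod>k<length (i # xs). 1 / real (card ((\<lambda>g. g ((i # xs) ! k)) `
              {g \<in> A. \<forall>l<k. g ((i # xs) ! l) = f ((i # xs) ! l)})))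
        = w {g \<in> A. g i = f i} f / card V" for f
    unfolding w_def V_def
    by (simp add: prod.lessThan_Suc_shift All_less_Suc2 conj_assoc del: prod.lessThan_Suc)
  have IH: "(\<Sum>f | f \<in> A \<and> f i = v. w {g \<in> A. g i = v} f) \<le> 1" for v
    using Cons.prems unfolding w_def by (intro order_trans[OF _ Cons.IH[of "{g \<in> A. g i = v}"]]) auto
  have "(\<Sum>f\<in>A. w {g \<in> A. g i = f i} f / card V)
      = (\<Sum>v\<in>V. \<Sum>f | f \<in> A \<and> f i = v. w {g \<in> A. g i = f i} f / card V)"
    unfolding V_def using Cons.prems(1) by (rule sum.image_gen)
  also have "\<dots> = (\<Sum>v\<in>V. (\<Sum>f | f \<in> A \<and> f i = v. w {g \<in> A. g i = v} f) / card V)"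
    by (auto simp: sum_divide_distrib intro!: sum.cong)
  also have "\<dots> \<le> (\<Sum>v\<in>V. 1 / card V)"
    using IH by (intro sum_mono divide_right_mono) auto
  also have "\<dots> \<le> 1" by simp
  finally show ?case unfolding w .
qed

text \<open>
  Given \<open>\<sigma> k\<close> and \<open>\<sigma> a\<close>, the value \<open>h (\<sigma> k) (\<sigma> a)\<close> is taken by \<open>\<sigma>\<close> at each of the other \<open>n - 2\<close>
  positions equally often, because composing \<open>\<sigma>\<close> with a transposition exchanges the positions.
\<close>

lemma card_permutations_condition:
  fixes h :: "nat \<Rightarrow> nat \<Rightarrow> nat"
  assumes h: "\<And>i r. i < n \<Longrightarrow> r < n \<Longrightarrow> i \<noteq> r \<Longrightarrow> h i r < n \<and> h i r \<noteq> i \<and> h i r \<noteq> r"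
    and "k < n" "a < n" "b < n" "k \<noteq> a" "k \<noteq> b" "a \<noteq> b"
  shows "card {\<sigma>. \<sigma> permutes {..<n} \<and> h (\<sigma> k) (\<sigma> a) = \<sigma> b} * (n - 2) = fact n"
proof -
  define P where "P = {\<sigma>. \<sigma> permutes {..<n}}"
  define E where "E c = {\<sigma>. \<sigma> permutes {..<n} \<and> h (\<sigma> k) (\<sigma> a) = \<sigma> c}" for c
  define C where "C = {..<n} - {k, a}"
  have fin: "finite P" unfolding P_def by (simp add: finite_permutations)
  have P: "P = (\<Union>c\<in>C. E c)"
  proof
    show "P \<subseteq> (\<Union>c\<in>C. E c)"
    proof
      fix \<sigma> assume "\<sigma> \<in> P"
      then have s: "\<sigma> permutes {..<n}" unfolding P_def by simp
      have "\<sigma> k < n" "\<sigma> a < n" "\<sigma> k \<noteq> \<sigma> a"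
        using assms permutes_in_image[OF s] permutes_inj[OF s] by (auto dest: injD)
      then have hs: "h (\<sigma> k) (\<sigma> a) < n" "h (\<sigma> k) (\<sigma> a) \<noteq> \<sigma> k" "h (\<sigma> k) (\<sigma> a) \<noteq> \<sigma> a"
        using h by blast+
      then have "h (\<sigma> k) (\<sigma> a) \<in> \<sigma> ` {..<n}" using permutes_image[OF s] by simp
      then obtain c where "c < n" "\<sigma> c = h (\<sigma> k) (\<sigma> a)" by auto
      then show "\<sigma> \<in> (\<Union>c\<in>C. E c)" unfolding C_def E_def using s hs by (auto intro!: bexI[of _ c])
    qed
  qed (auto simp: P_def E_def)
  have "card (E c) = card (E b)" if "c \<in> C" for c
  proof -
    have t: "transpose b c permutes {..<n}" 
      using that assms by (intro permutes_swap_id) (auto simp: C_def)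
    have tt: "transpose b c k = k" "transpose b c a = a"
      using that assms by (auto simp: C_def transpose_def)
    have "bij_betw (\<lambda>\<sigma>. \<sigma> \<circ> transpose b c) (E c) (E b)"
      by (rule bij_betw_byWitness[where f' = "\<lambda>\<sigma>. \<sigma> \<circ> transpose b c"])
        (auto simp: E_def comp_assoc tt t permutes_compose)
    then show ?thesis by (rule bij_betw_same_card)
  qed
  moreover have "card P = (\<Sum>c\<in>C. card (E c))"
    unfolding P
  proof (rule card_UN_disjoint)
    show "\<forall>i\<in>C. finite (E i)" using fin unfolding E_def P_def by (auto intro: finite_subset)
    show "\<forall>i\<in>C. \<forall>j\<in>C. i \<noteq> j \<longrightarrow> E i \<inter> E j = {}"
      unfolding E_def by (auto dest!: permutes_inj simp: inj_eq)
  qed (simp add: C_def)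
  moreover have "card P = fact n" unfolding P_def by (simp add: card_permutations)
  moreover have "card C = n - 2"
    unfolding C_def using assms by (simp add: card_Diff_subset)
  ultimately show ?thesis unfolding E_def by (simp add: mult.commute)
qed

text \<open>Double counting of triples of a permutation and two later positions
  \<open>a \<noteq> b\<close> with \<open>h (\<sigma> k) (\<sigma> a) = \<sigma> b\<close>. There
  are \<open>(n - 1 - k) * (n - 2 - k)\<close> pairs of positions, each satisfied by a fraction
  \<open>1 / (n - 2)\<close> of the permutations; the factor \<open>n - 2\<close> on the left keeps
  the identity in the naturals.\<close>

lemma sum_card_permutations_condition:
  fixes h :: "nat \<Rightarrow> nat \<Rightarrow> nat"
  assumes h: "\<And>i r. i < n \<Longrightarrow> r < n \<Longrightarrow> i \<noteq> r \<Longrightarrow> h i r < n \<and> h i r \<noteq> i \<and> h i r \<noteq> r"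
    and "k < n"
  shows "(\<Sum>\<sigma> | \<sigma> permutes {..<n}. card {a \<in> {k<..<n}. h (\<sigma> k) (\<sigma> a) \<in> \<sigma> ` {k<..<n}}) * (n - 2)
       = fact n * ((n - 1 - k) * (n - 2 - k))"
proof -
  define P where "P = {\<sigma>. \<sigma> permutes {..<n}}"
  define I where "I = {k<..<n}"
  have finP: "finite P" unfolding P_def by (simp add: finite_permutations)
  have finI: "finite I" unfolding I_def by simp
  have *: "card {a \<in> I. h (\<sigma> k) (\<sigma> a) \<in> \<sigma> ` I}
      = (\<Sum>a\<in>I. \<Sum>b\<in>I - {a}. if h (\<sigma> k) (\<sigma> a) = \<sigma> b then 1 else 0)" if "\<sigma> \<in> P" for \<sigma>
  proof -
    have s: "\<sigma> permutes {..<n}" using that unfolding P_def by simp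
    have inj: "\<sigma> x = \<sigma> y \<longleftrightarrow> x = y" for x y using permutes_inj[OF s] by (simp add: inj_eq)
    \<comment> \<open>At most one \<open>b\<close> contributes because \<open>\<sigma>\<close> is
      injective, and \<open>b = a\<close> is impossible because \<open>h\<close> never returns its
      second argument.\<close>
    have "(\<Sum>b\<in>I - {a}. if h (\<sigma> k) (\<sigma> a) = \<sigma> b then 1 else 0 :: nat)
        = (if h (\<sigma> k) (\<sigma> a) \<in> \<sigma> ` I then 1 else 0)" if "a \<in> I" for a
    proof -
      have "\<sigma> k < n" "\<sigma> a < n" "\<sigma> k \<noteq> \<sigma> a"
        using that \<open>k < n\<close> permutes_in_image[OF s] by (auto simp: I_def inj)
      then have ha: "h (\<sigma> k) (\<sigma> a) \<noteq> \<sigma> a" using h by blast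
      show ?thesis
      proof (cases "h (\<sigma> k) (\<sigma> a) \<in> \<sigma> ` I")
        case True
        then obtain c where c: "c \<in> I" "h (\<sigma> k) (\<sigma> a) = \<sigma> c" by auto
        then show ?thesis using ha finI True by (simp add: inj c(2))
      next
        case False
        then have "(\<Sum>b\<in>I - {a}. if h (\<sigma> k) (\<sigma> a) = \<sigma> b then 1 else 0 :: nat) = 0"
          by (intro sum.neutral) auto
        with False show ?thesis by simp
      qed
    qed
    then show ?thesis using finI by (simp add: sum.If_cases Int_def conj_commute)
  qed
  have "(\<Sum>\<sigma>\<in>P. card {a \<in> I. h (\<sigma> k) (\<sigma> a) \<in> \<sigma> ` I})
      = (\<Sum>\<sigma>\<in>P. \<Sum>a\<in>I. \<Sum>b\<in>I - {a}. if h (\<sigma> k) (\<sigma> a) = \<sigma> b then 1 else 0)"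
    using * by (rule sum.cong[OF refl])
  also have "\<dots> = (\<Sum>a\<in>I. \<Sum>b\<in>I - {a}. \<Sum>\<sigma>\<in>P. if h (\<sigma> k) (\<sigma> a) = \<sigma> b then 1 else 0)"
    by (subst sum.swap, intro sum.cong refl, subst sum.swap, rule refl)
  also have "\<dots> = (\<Sum>a\<in>I. \<Sum>b\<in>I - {a}. card {\<sigma>. \<sigma> permutes {..<n} \<and> h (\<sigma> k) (\<sigma> a) = \<sigma> b})"
    using finP by (simp add: sum.If_cases) (simp add: P_def Int_def)
  finally have "(\<Sum>\<sigma>\<in>P. card {a \<in> I. h (\<sigma> k) (\<sigma> a) \<in> \<sigma> ` I}) * (n - 2)
      = (\<Sum>a\<in>I. \<Sum>b\<in>I - {a}. card {\<sigma>. \<sigma> permutes {..<n} \<and> h (\<sigma> k) (\<sigma> a) = \<sigma> b} * (n - 2))"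
    by (simp add: sum_distrib_right)
  also have "\<dots> = (\<Sum>a\<in>I. \<Sum>b\<in>I - {a}. fact n)"
    using h \<open>k < n\<close> by (intro sum.cong refl card_permutations_condition) (auto simp: I_def)
  also have "\<dots> = fact n * ((n - 1 - k) * (n - 2 - k))"
    using finI by (simp add: card_Diff_singleton I_def)
  finally show ?thesis unfolding P_def I_def .
qed

text \<open>
  Fill the rows in the order \<open>\<sigma>\<close>. Row \<open>\<sigma> k\<close> can only use columns and symbols that \<open>f\<close> itself uses in
  the rows \<open>\<sigma> k, \<dots>, \<sigma> (n - 1)\<close>; \<open>h i r\<close> is the row in which \<open>f\<close> uses the symbol at the
  intersection of row \<open>i\<close> with the column of its cell in row \<open>r\<close>.
\<close>

lemma card_choices_le:
  assumes L: "latin_square n L" and f: "f \<in> tperms n L" and s: "\<sigma> permutes {..<n}" and "k < n"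
    and h: "\<And>i r. i < n \<Longrightarrow> r < n \<Longrightarrow> h i r < n \<and> L (h i r) (f (h i r)) = L i (f r)"
  shows "card ((\<lambda>g. g (\<sigma> k)) ` {g \<in> tperms n L. \<forall>l<k. g (\<sigma> l) = f (\<sigma> l)})
       \<le> 1 + card {a \<in> {k<..<n}. h (\<sigma> k) (\<sigma> a) \<in> \<sigma> ` {k<..<n}}" (is "card ?V \<le> 1 + card ?I")
proof -
  have sn: "\<sigma> x < n \<longleftrightarrow> x < n" for x using permutes_in_image[OF s] by simp
  have surj: "\<exists>x<n. \<sigma> x = y" if "y < n" for y
  proof -
    have "y \<in> \<sigma> ` {..<n}" using that permutes_image[OF s] by simp
    then show ?thesis by auto
  qed
  have "?V \<subseteq> insert (f (\<sigma> k)) ((\<lambda>a. f (\<sigma> a)) ` ?I)"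
  proof
    fix j assume "j \<in> ?V"
    then obtain g where g: "g \<in> tperms n L" "\<And>l. l < k \<Longrightarrow> g (\<sigma> l) = f (\<sigma> l)" "j = g (\<sigma> k)"
      by auto
    have gp: "g permutes {..<n}" "inj_on (\<lambda>i. L i (g i)) {..<n}"
      and fp: "f permutes {..<n}" "inj_on (\<lambda>i. L i (f i)) {..<n}"
      using g(1) f unfolding tperms_def by auto
    have ne: "\<sigma> l \<noteq> \<sigma> k" if "l < k" for l
      using that permutes_inj[OF s] by (auto dest: injD)
    have "j < n" using g(3) permutes_in_image[OF gp(1)] sn \<open>k < n\<close> by simp
    then have "j \<in> f ` {..<n}" using permutes_image[OF fp(1)] by simp
    then obtain r where r: "r < n" "j = f r" by auto
    then obtain a where a: "a < n" "j = f (\<sigma> a)" using surj by blast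
    \<comment> \<open>Columns of earlier rows are taken: there \<open>g\<close> agrees with
      \<open>f\<close>.\<close>
    have "\<not> a < k"
    proof
      assume "a < k"
      then have "g (\<sigma> a) = g (\<sigma> k)" using g a by simp
      then show False using ne[OF \<open>a < k\<close>] permutes_inj[OF gp(1)] by (auto dest: injD)
    qed
    show "j \<in> insert (f (\<sigma> k)) ((\<lambda>a. f (\<sigma> a)) ` ?I)"
    proof (cases "a = k")
      case False
      have hk: "h (\<sigma> k) (\<sigma> a) < n" "L (h (\<sigma> k) (\<sigma> a)) (f (h (\<sigma> k) (\<sigma> a))) = L (\<sigma> k) j"
        using h[of "\<sigma> k" "\<sigma> a"] sn \<open>k < n\<close> a by auto
      obtain b where b: "b < n" "\<sigma> b = h (\<sigma> k) (\<sigma> a)" using surj hk(1) by blast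
      \<comment> \<open>The symbol at column \<open>j\<close> of row \<open>\<sigma> k\<close> would
        already have been used by \<open>g\<close> in row \<open>\<sigma> b\<close>.\<close>
      have "\<not> b < k"
      proof
        assume "b < k"
        then have "L (\<sigma> b) (g (\<sigma> b)) = L (\<sigma> k) (g (\<sigma> k))" using hk(2) g by (simp add: b(2)[symmetric])
        then show False using ne[OF \<open>b < k\<close>] gp(2) sn b(1) \<open>k < n\<close> by (auto dest: inj_onD)
      qed
      moreover have "b \<noteq> k"
      proof
        assume "b = k"
        then have "L (\<sigma> k) (f (\<sigma> k)) = L (\<sigma> k) (f (\<sigma> a))" using hk(2) a b by simp
        moreover have "f (\<sigma> k) < n" "f (\<sigma> a) < n"
          using permutes_in_image[OF fp(1)] sn \<open>k < n\<close> a by auto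
        ultimately have "f (\<sigma> k) = f (\<sigma> a)"
          using latin_square_row_inject[OF L] sn \<open>k < n\<close> by blast
        then show False using False permutes_inj[OF fp(1)] permutes_inj[OF s] by (auto dest: injD)
      qed
      ultimately have "a \<in> ?I" using False \<open>\<not> a < k\<close> a b by (auto simp flip: b(2))
      then show ?thesis using a by auto
    qed (use a in auto)
  qed
  then have "card ?V \<le> card (insert (f (\<sigma> k)) ((\<lambda>a. f (\<sigma> a)) ` ?I))"
    by (intro card_mono) auto
  also have "\<dots> \<le> Suc (card ((\<lambda>a. f (\<sigma> a)) ` ?I))" by (rule card_insert_le_m1) auto
  also have "\<dots> \<le> 1 + card ?I" by (simp add: card_image_le)
  finally show ?thesis .
qed

text \<open>
  This replaces Jensen's inequality: with \<open>y\<^sub>k = \<mu>\<^sub>k / x\<^sub>k\<close> we have \<open>\<Prod>y\<^sub>k \<ge> 1 + \<Sum>ln y\<^sub>k\<close> and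
  \<open>ln y\<^sub>k \<ge> 1 - 1 / y\<^sub>k\<close>.
\<close>

lemma prod_ratio_ge:
  fixes x \<mu> :: "'a \<Rightarrow> real"
  assumes "finite K" "\<And>k. k \<in> K \<Longrightarrow> x k > 0" "\<And>k. k \<in> K \<Longrightarrow> \<mu> k > 0"
  shows "(\<Prod>k\<in>K. \<mu> k / x k) \<ge> 1 - (\<Sum>k\<in>K. x k / \<mu> k - 1)"
proof -
  define y where "y k = \<mu> k / x k" for k
  have y: "y k > 0" if "k \<in> K" for k using assms that unfolding y_def by simp
  have "1 - (\<Sum>k\<in>K. x k / \<mu> k - 1) = 1 + (\<Sum>k\<in>K. 1 - x k / \<mu> k)"
    by (simp add: sum_negf[symmetric])
  also have "\<dots> \<le> 1 + (\<Sum>k\<in>K. ln (y k))"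
  proof (intro add_left_mono sum_mono)
    fix k assume "k \<in> K"
    then have "ln (x k / \<mu> k) \<le> x k / \<mu> k - 1" using assms by (intro ln_le_minus_one) auto
    moreover have "ln (y k) = - ln (x k / \<mu> k)"
      using assms \<open>k \<in> K\<close> unfolding y_def by (simp add: ln_div)
    ultimately show "1 - x k / \<mu> k \<le> ln (y k)" by simp
  qed
  also have "\<dots> = 1 + ln (\<Prod>k\<in>K. y k)" using y assms(1) by (subst ln_prod) (auto simp: less_imp_neq[THEN not_sym])
  also have "\<dots> \<le> (\<Prod>k\<in>K. y k)"
    using ln_le_minus_one[of "\<Prod>k\<in>K. y k"] y by (simp add: prod_pos)
  finally show ?thesis unfolding y_def .
qed

text \<open>The sum of \<open>\<Prod>k<n. \<mu> k / N \<sigma> f k\<close> over all pairs of an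
  order \<open>\<sigma>\<close> and a transversal \<open>f\<close> is estimated twice: from below
  for each fixed \<open>f\<close> by convexity, from above for each fixed \<open>\<sigma>\<close> by
  the probability bound.\<close>

lemma card_tperms_le_prod:
  assumes L: "latin_square n L" and "n \<ge> 3"
  shows "real (card (tperms n L)) \<le> (\<Prod>k<n. 1 + real ((n - 1 - k) * (n - 2 - k)) / real (n - 2))"
proof -
  define P where "P = {\<sigma>. \<sigma> permutes {..<n}}"
  define \<mu> where "\<mu> k = 1 + real ((n - 1 - k) * (n - 2 - k)) / real (n - 2)" for k
  define N where "N \<sigma> f k = real (card ((\<lambda>g. g (\<sigma> k)) ` {g \<in> tperms n L. \<forall>l<k. g (\<sigma> l) = f (\<sigma> l)}))"
    for \<sigma> :: "nat \<Rightarrow> nat" and f :: "nat \<Rightarrow> nat" and k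
  have finP: "finite P" and cardP: "card P = fact n"
    unfolding P_def by (simp_all add: finite_permutations card_permutations)
  have \<mu>: "\<mu> k > 0" for k unfolding \<mu>_def by (simp add: add_pos_nonneg)
  have sum_le: "(\<Sum>f\<in>tperms n L. \<Prod>k<n. 1 / N \<sigma> f k) \<le> 1" if "\<sigma> \<in> P" for \<sigma>
  proof -
    have s: "\<sigma> permutes {..<n}" using that P_def by simp
    have "f = g" if "f \<in> tperms n L" "g \<in> tperms n L" "\<forall>i\<in>\<sigma> ` {..<n}. f i = g i" for f g
    proof
      fix i show "f i = g i"
        using that permutes_image[OF s] unfolding tperms_def
        by (cases "i < n") (auto simp: permutes_not_in)
    qed
    then have "(\<Sum>f\<in>tperms n L. \<Prod>k<length (map \<sigma> [0..<n]).
      1 / real (card ((\<lambda>g. g (map \<sigma> [0..<n] ! k)) ` {g \<in> tperms n L. \<forall>l<k. g (map \<sigma> [0..<n] ! l) = f (map \<sigma> [0..<n] ! l)}))) \<le> 1"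
      by (intro sum_inverse_choices_le_1) (auto simp: lessThan_atLeast0)
    also have "(\<Sum>f\<in>tperms n L. \<Prod>k<length (map \<sigma> [0..<n]).
      1 / real (card ((\<lambda>g. g (map \<sigma> [0..<n] ! k)) ` {g \<in> tperms n L. \<forall>l<k. g (map \<sigma> [0..<n] ! l) = f (map \<sigma> [0..<n] ! l)})))
      = (\<Sum>f\<in>tperms n L. \<Prod>k<n. 1 / N \<sigma> f k)"
      unfolding N_def
      by (intro sum.cong prod.cong refl arg_cong[where f = "\<lambda>x. 1 / real (card x)"] image_cong Collect_cong) auto
    finally show ?thesis .
  qed
  have avg: "real (fact n) \<le> (\<Sum>\<sigma>\<in>P. \<Prod>k<n. \<mu> k / N \<sigma> f k)" if f: "f \<in> tperms n L" for f
  proof -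
    have fp: "f permutes {..<n}" "inj_on (\<lambda>i. L i (f i)) {..<n}"
      using f unfolding tperms_def by auto
    have Ln: "L i j < n" if "i < n" "j < n" for i j
      using latin_square_less[OF L] that by simp
    have fn: "f i < n" if "i < n" for i using permutes_in_image[OF fp(1)] that by simp
    have "(\<lambda>i. L i (f i)) ` {..<n} = {..<n}"
      using fp(2) Ln fn by (intro endo_inj_surj) auto
    then have "\<exists>r'<n. L r' (f r') = L i (f r)" if "i < n" "r < n" for i r
      using Ln[OF that(1) fn[OF that(2)]] by (metis (no_types, lifting) imageE lessThan_iff)
    then obtain h where h: "\<And>i r. i < n \<Longrightarrow> r < n \<Longrightarrow> h i r < n \<and> L (h i r) (f (h i r)) = L i (f r)"
      by metis
    have h': "h i r < n \<and> h i r \<noteq> i \<and> h i r \<noteq> r" if "i < n" "r < n" "i \<noteq> r" for i r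
    proof -
      have "h i r \<noteq> i"
      proof
        assume "h i r = i"
        then have "L i (f i) = L i (f r)" using h[OF that(1,2)] by simp
        then have "f i = f r"
          using latin_square_row_inject[OF L] fn that by blast
        then show False using that(3) permutes_inj[OF fp(1)] by (auto dest: injD)
      qed
      moreover have "h i r \<noteq> r"
      proof
        assume "h i r = r"
        then have "L r (f r) = L i (f r)" using h[OF that(1,2)] by simp
        then show False using latin_square_column_inject[OF L] fn that by metis
      qed
      ultimately show ?thesis using h[OF that(1,2)] by simp
    qed
    define M where "M \<sigma> k = real (1 + card {a \<in> {k<..<n}. h (\<sigma> k) (\<sigma> a) \<in> \<sigma> ` {k<..<n}})"
      for \<sigma> :: "nat \<Rightarrow> nat" and k
    \<comment> \<open>\<open>\<mu> k\<close> is exactly the mean of \<open>M \<sigma> k\<close> over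
      \<open>\<sigma>\<close>.\<close>
    have sumM: "(\<Sum>\<sigma>\<in>P. M \<sigma> k / \<mu> k - 1) = 0" if "k < n" for k
    proof -
      have "real ((\<Sum>\<sigma>\<in>P. card {a \<in> {k<..<n}. h (\<sigma> k) (\<sigma> a) \<in> \<sigma> ` {k<..<n}}) * (n - 2))
         = real (fact n * ((n - 1 - k) * (n - 2 - k)))"
        unfolding P_def using sum_card_permutations_condition[of n h k] h' that by simp
      then have "(\<Sum>\<sigma>\<in>P. M \<sigma> k) = real (fact n) * \<mu> k"
        using \<open>n \<ge> 3\<close> unfolding M_def \<mu>_def by (simp add: sum.distrib cardP field_simps)
      then show ?thesis using \<mu>[of k] by (simp add: sum_subtractf cardP flip: sum_divide_distrib)
    qed
    \<comment> \<open>The deviations from the mean cancel in the sum over \<open>\<sigma>\<close>,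
      so only the constant term of \<open>prod_ratio_ge\<close> survives.\<close>
    have "real (fact n) = (\<Sum>\<sigma>\<in>P. 1 - (\<Sum>k<n. M \<sigma> k / \<mu> k - 1))"
      using sumM by (simp add: sum_subtractf[of "\<lambda>_. 1"] sum.swap[of _ "{..<n}" P] cardP)
    also have "\<dots> \<le> (\<Sum>\<sigma>\<in>P. \<Prod>k<n. \<mu> k / M \<sigma> k)"
      using \<mu> by (intro sum_mono prod_ratio_ge) (auto simp: M_def)
    also have "\<dots> \<le> (\<Sum>\<sigma>\<in>P. \<Prod>k<n. \<mu> k / N \<sigma> f k)"
    proof (intro sum_mono prod_mono conjI)
      fix \<sigma> k assume "\<sigma> \<in> P" and k: "k \<in> {..<n}"
      then have s: "\<sigma> permutes {..<n}" unfolding P_def by simp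
      have "N \<sigma> f k \<le> M \<sigma> k"
        unfolding N_def M_def using card_choices_le[OF L f s _ h] k by (simp only: of_nat_le_iff lessThan_iff)
      moreover have "0 < N \<sigma> f k"
        unfolding N_def using f by (auto simp: card_gt_0_iff)
      ultimately show "\<mu> k / M \<sigma> k \<le> \<mu> k / N \<sigma> f k" using \<mu>[of k] by (intro divide_left_mono) auto
      show "0 \<le> \<mu> k / M \<sigma> k" using \<mu>[of k] unfolding M_def by simp
    qed
    finally show ?thesis .
  qed
  have "real (card (tperms n L)) * real (fact n) = (\<Sum>f\<in>tperms n L. real (fact n))" by simp
  also have "\<dots> \<le> (\<Sum>f\<in>tperms n L. \<Sum>\<sigma>\<in>P. \<Prod>k<n. \<mu> k / N \<sigma> f k)"
    using avg by (rule sum_mono)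
  also have "\<dots> = (\<Prod>k<n. \<mu> k) * (\<Sum>\<sigma>\<in>P. \<Sum>f\<in>tperms n L. \<Prod>k<n. 1 / N \<sigma> f k)"
    by (subst sum.swap) (simp add: sum_distrib_left flip: prod.distrib)
  also have "\<dots> \<le> (\<Prod>k<n. \<mu> k) * (\<Sum>\<sigma>\<in>P. 1)"
    using sum_le \<mu> by (intro mult_left_mono sum_mono prod_nonneg) (auto intro: less_imp_le)
  finally have "real (card (tperms n L)) * real (fact n) \<le> (\<Prod>k<n. \<mu> k) * real (fact n)"
    by (simp add: cardP)
  then show ?thesis unfolding \<mu>_def by simp
qed

section \<open>Growth of the product bound\<close>

definition transversal_bound :: "nat \<Rightarrow> real" where
  "transversal_bound n = (\<Prod>m<n. 1 + real (m * (m - 1)) / real (n - 2))"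

lemma T_le_transversal_bound: "n \<ge> 3 \<Longrightarrow> real (T n) \<le> transversal_bound n"
proof -
  assume n: "n \<ge> 3"
  obtain L where L: "latin_square n L" "T n = card (tperms n L)" using T_attained by blast
  have "transversal_bound n = (\<Prod>k<n. 1 + real ((n - 1 - k) * (n - 2 - k)) / real (n - 2))"
    unfolding transversal_bound_def
    \<comment> \<open>Reindexing by the number \<open>m = n - 1 - k\<close> of rows left after the
      current one.\<close>
    by (subst prod.nat_diff_reindex[symmetric]) (intro prod.cong, auto simp: numeral_2_eq_2)
  then show ?thesis using card_tperms_le_prod[OF L(1) n] L(2) by simp
qed

text \<open>This controls the ratio of consecutive product bounds. The right-hand side is
  \<open>n - 495/1000 * (n - 1)\<close>, the form in which it yields a factor
  \<open>exp (- (495/1000))\<close>. The first five terms are kept exactly and the rest is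
  telescoped.\<close>

lemma sum_quotient_le:
  fixes n :: nat
  assumes "n \<ge> 6"
  shows "(\<Sum>m<n. real (n - 2) / (real (n - 2) + real (m * (m - 1)))) \<le> 505/1000 * real n + 495/1000"
proof -
  define x where "x = real n"
  define y where "y = x - 6"
  have x: "x = 6 + y" and y: "y \<ge> 0" using assms unfolding x_def y_def by auto
  define g where "g m = (x - 2) / ((x - 2) + real (m * (m - 1)))" for m :: nat
  \<comment> \<open>Dropping \<open>x - 2\<close> from the denominator leaves
    \<open>1 / (m * (m - 1))\<close>, which telescopes; \<open>1/4\<close> is the starting value
    \<open>1 / (5 - 1)\<close>.\<close>
  have tail: "(\<Sum>m=5..<N. g m) \<le> (x - 2) * (1/4 - 1 / (real N - 1))" if "N \<ge> 5" for N
    using that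
  proof (induction N rule: dec_induct)
    case (step N)
    have "g N \<le> (x - 2) / real (N * (N - 1))"
      unfolding g_def using y x step(1) by (intro divide_left_mono mult_pos_pos add_nonneg_pos) auto
    also have "\<dots> = (x - 2) * (1 / (real N - 1) - 1 / (real (Suc N) - 1))"
      using step(1) by (auto simp: field_simps of_nat_diff)
    finally have "(\<Sum>m=5..<Suc N. g m) \<le> (x - 2) * (1/4 - 1 / (real N - 1))
        + (x - 2) * (1 / (real N - 1) - 1 / (real (Suc N) - 1))"
      using step by simp
    then show ?case by (simp only: diff_add_cancel flip: distrib_left) simp
  qed simp
  have "(\<Sum>m<n. real (n - 2) / (real (n - 2) + real (m * (m - 1)))) = (\<Sum>m<n. g m)"
    unfolding g_def x_def using assms by (simp add: of_nat_diff)
  also have "\<dots> = (\<Sum>m<5. g m) + (\<Sum>m=5..<n. g m)"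
    using sum.atLeastLessThan_concat[of 0 5 n g] assms by (simp add: lessThan_atLeast0)
  also have "\<dots> \<le> (\<Sum>m<5. g m) + (x - 2) * (1/4 - 1 / (x - 1))"
    using tail[of n] assms unfolding x_def by simp
  also have "(\<Sum>m<5. g m) = 2 + (x - 2) / x + (x - 2) / (x + 4) + (x - 2) / (x + 10)"
    using y x by (simp add: g_def eval_nat_numeral)
  \<comment> \<open>In terms of \<open>y = x - 6\<close> every coefficient of the subtracted
    numerator is nonnegative.\<close>
  also have "2 + (x - 2) / x + (x - 2) / (x + 4) + (x - 2) / (x + 10) + (x - 2) * (1/4 - 1 / (x - 1))
      = 505/1000 * x + 495/1000
        - (40 + 1315/2 * y + 1948/5 * y^2 + 17161/200 * y^3 + 199/25 * y^4 + 51/200 * y^5)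
          / (x * (x + 4) * (x + 10) * (x - 1))"
    using y unfolding x by (simp add: divide_simps) (simp add: algebra_simps eval_nat_numeral)
  also have "\<dots> \<le> 505/1000 * x + 495/1000"
    using y unfolding x by simp
  finally show ?thesis unfolding x_def .
qed

text \<open>The new factor \<open>m = n\<close> equals \<open>Suc n\<close>. In the other factors
  the denominator grows from \<open>u\<close> to \<open>u + 1\<close>, which multiplies them by
  \<open>1 - (1 - u / (u + a m)) / (u + 1)\<close>. Bounding this by an exponential turns the
  product into the sum of \<open>sum_quotient_le\<close>.\<close>

lemma transversal_bound_Suc:
  assumes "n \<ge> 6"
  shows "transversal_bound (Suc n) \<le> real (Suc n) * exp (- (495/1000)) * transversal_bound n"
proof -
  define a where "a m = real (m * (m - 1))" for m :: nat
  have a: "a m \<ge> 0" for m unfolding a_def by simp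
  define u where "u = real (n - 2)"
  have u: "u > 0" "real (n - 1) = u + 1" "real n = u + 2" using assms unfolding u_def by auto
  have "transversal_bound (Suc n) = real (Suc n) * (\<Prod>m<n. 1 + a m / (u + 1))"
    using u by (simp add: transversal_bound_def a_def add.commute)
  also have "(\<Prod>m<n. 1 + a m / (u + 1))
      \<le> (\<Prod>m<n. (1 + a m / u) * exp (- (1 - u / (u + a m)) / (u + 1)))"
  proof (intro prod_mono conjI)
    fix m
    have nz: "u + a m > 0" using u(1) a[of m] by simp
    have "1 + a m / (u + 1) = (1 + a m / u) * (1 + - (1 - u / (u + a m)) / (u + 1))"
      using u(1) nz by (simp add: divide_simps) (simp add: algebra_simps)
    also have "\<dots> \<le> (1 + a m / u) * exp (- (1 - u / (u + a m)) / (u + 1))"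
      using u(1) a[of m] by (intro mult_left_mono exp_ge_add_one_self) auto
    finally show "1 + a m / (u + 1) \<le> \<dots>" .
    show "0 \<le> 1 + a m / (u + 1)" using u(1) a[of m] by simp
  qed
  also have "\<dots> = transversal_bound n * exp (\<Sum>m<n. - (1 - u / (u + a m)) / (u + 1))"
    by (simp add: prod.distrib exp_sum transversal_bound_def a_def u_def)
  also have "\<dots> \<le> transversal_bound n * exp (- (495/1000))"
  proof -
    have "(\<Sum>m<n. - (1 - u / (u + a m)) / (u + 1)) = ((\<Sum>m<n. u / (u + a m)) - real n) / (u + 1)"
      by (simp add: sum_subtractf flip: sum_divide_distrib)
    also have "\<dots> \<le> (505/1000 * real n + 495/1000 - real n) / (u + 1)"
      using sum_quotient_le[OF assms] u(1) unfolding u_def a_def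
      by (intro divide_right_mono) auto
    also have "\<dots> = - (495/1000)" using u by (simp add: field_simps)
    finally show ?thesis
      by (intro mult_left_mono) (auto simp: transversal_bound_def intro!: prod_nonneg)
  qed
  finally show ?thesis by (simp add: mult_ac mult_left_mono)
qed

section \<open>Comparison with the constant of the upper bound\<close>

lemma exp_ge_sum: "0 \<le> x \<Longrightarrow> (\<Sum>k<n. x ^ k / fact k) \<le> exp (x::real)"
  unfolding exp_def using summable_exp_generic[of x]
  by (intro order_trans[OF _ sum_le_suminf[of _ "{..<n}"]]) (auto simp: divide_inverse mult.commute)

definition transversal_base :: real where
  "transversal_base = sqrt ((3 - sqrt 3) / 6) * exp (sqrt 3 / 6)"

text \<open>Squaring removes the outer root and leaves
  \<open>(3 - sqrt 3) / 6 * exp (sqrt 3 / 3)\<close>. Here \<open>0.577\<close> lies below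
  \<open>sqrt 3 / 3\<close>, and four terms of the exponential series suffice.\<close>

lemma transversal_base_ge: "transversal_base \<ge> 61/100"
proof -
  have s: "sqrt 3 \<ge> 1732/1000" "sqrt 3 \<le> 17321/10000"
    by (rule real_le_rsqrt real_le_lsqrt; simp add: power2_eq_square)+
  have "(61/100)\<^sup>2 \<le> (3 - 17321/10000) / 6 * (1 + 0.577 + 0.577^2 / 2 + 0.577^3 / (6::real))"
    by (simp add: power2_eq_square power3_eq_cube)
  also have "\<dots> \<le> (3 - sqrt 3) / 6 * exp (0.577)"
    using s exp_ge_sum[of "0.577" 4] by (intro mult_mono) (auto simp: eval_nat_numeral)
  also have "\<dots> \<le> (3 - sqrt 3) / 6 * exp (2 * (sqrt 3 / 6))"
    using s by (intro mult_left_mono) auto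
  also have "\<dots> = transversal_base\<^sup>2"
    using s unfolding transversal_base_def by (simp add: power_mult_distrib flip: exp_double)
  finally have "(61/100)\<^sup>2 \<le> transversal_base\<^sup>2" .
  moreover have "0 \<le> transversal_base" using s unfolding transversal_base_def by simp
  ultimately show ?thesis by (rule power2_le_imp_le)
qed

lemma exp_minus_le: "exp (- (495/1000)) \<le> (61/100 :: real)"
proof -
  have "100/61 \<le> exp (495/1000 :: real)"
    using exp_ge_sum[of "495/1000" 5] by (simp add: eval_nat_numeral)
  then show ?thesis by (simp add: exp_minus field_simps)
qed

text \<open>From \<open>n\<close> to \<open>n + 1\<close> the left side grows by at most
  \<open>(n + 1) * 61/100\<close> and the right side by at least
  \<open>(n + 1) * transversal_base\<close>. The base case is tight: 90 against about 90.8 after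
  rounding \<open>transversal_base\<close> and \<open>sqrt 6\<close> down.\<close>

lemma transversal_bound_le:
  assumes "n \<ge> 6"
  shows "transversal_bound n \<le> transversal_base ^ n * sqrt (real n) * fact n"
  using assms
proof (induction n rule: dec_induct)
  case base
  have "sqrt 6 \<ge> (2449/1000 :: real)"
    by (rule real_le_rsqrt) (simp add: power2_eq_square)
  have "transversal_bound 6 = 90"
    by (simp add: transversal_bound_def eval_nat_numeral)
  also have "\<dots> \<le> (61/100) ^ 6 * (2449/1000) * fact 6" 
    by (simp add: fact_numeral power_divide)
  also have "\<dots> \<le> transversal_base ^ 6 * sqrt (real 6) * fact 6"
    using transversal_base_ge \<open>sqrt 6 \<ge> _\<close> by (intro mult_right_mono mult_mono power_mono) auto
  finally show ?case .
next
  case (step n)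
  have "transversal_bound (Suc n) \<le> real (Suc n) * exp (- (495/1000)) * transversal_bound n"
    using step by (intro transversal_bound_Suc) simp
  also have "\<dots> \<le> real (Suc n) * transversal_base * (transversal_base ^ n * sqrt (real (Suc n)) * fact n)"
  proof (intro mult_mono)
    show "exp (- (495/1000)) \<le> transversal_base"
      using exp_minus_le transversal_base_ge by linarith
    have "transversal_base ^ n * sqrt (real n) * fact n \<le> transversal_base ^ n * sqrt (real (Suc n)) * fact n"
      using transversal_base_ge by (intro mult_mono) auto
    with step.IH show "transversal_bound n \<le> transversal_base ^ n * sqrt (real (Suc n)) * fact n"
      by linarith
  qed (use transversal_base_ge in \<open>auto simp: transversal_bound_def intro!: prod_nonneg\<close>)
  finally show ?case by (simp add: algebra_simps)
qed

section \<open>Order 5\<close>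

lemma tperms_5_eqI:
  assumes L: "latin_square 5 L" and p: "p \<in> tperms 5 L" and q: "q \<in> tperms 5 L"
    and "p 0 = q 0" "p 1 = q 1"
  shows "p = q"
proof (rule ccontr)
  have perm: "p permutes {..<5}" "q permutes {..<5}"
    and sym: "inj_on (\<lambda>i. L i (p i)) {..<5}" "inj_on (\<lambda>i. L i (q i)) {..<5}"
    using p q unfolding tperms_def by auto
  have inj: "p i = p j \<longleftrightarrow> i = j" "q i = q j \<longleftrightarrow> i = j" for i j
    using perm[THEN permutes_inj] by (simp_all add: inj_eq)
  have less: "p i < 5 \<longleftrightarrow> i < 5" "q i < 5 \<longleftrightarrow> i < 5" for i
    using perm[THEN permutes_in_image] by auto
  have surj: "\<exists>i<5. p i = j" "\<exists>i<5. q i = j" if "j < 5" for j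
  proof -
    have "j \<in> p ` {..<5}" "j \<in> q ` {..<5}" using that perm[THEN permutes_image] by simp_all
    then show "\<exists>i<5. p i = j" "\<exists>i<5. q i = j" by auto
  qed
  have symp: "L i (p i) = L j (p j) \<longleftrightarrow> i = j" and symq: "L i (q i) = L j (q j) \<longleftrightarrow> i = j"
    if "i < 5" "j < 5" for i j
    using sym that by (auto dest: inj_onD)
  have five: "i = 0 \<or> i = 1 \<or> i = 2 \<or> i = 3 \<or> i = 4" if "i < 5" for i :: nat
    using that by auto
  have pq: "p i = q i" if "i < 2" for i using that assms(4,5) by (auto simp: less_2_cases_iff)
  assume "p \<noteq> q"
  then obtain a where a: "p a \<noteq> q a" by auto
  have a5: "a < 5" using a perm[THEN permutes_not_in] by force
  have a2: "2 \<le> a" using a pq[of a] by linarith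
  \<comment> \<open>\<open>b\<close> is the row in which \<open>p\<close> uses the column that
    \<open>q\<close> uses in row \<open>a\<close>.\<close>
  obtain b where b: "b < 5" "p b = q a" using surj[of "q a"] less a5 by auto
  have ba: "b \<noteq> a" using a b by auto
  have b2: "2 \<le> b" using pq[of b] b ba inj by (metis not_le)
  \<comment> \<open>The third remaining row, as \<open>2 + 3 + 4 = 9\<close>.\<close>
  define c where "c = 9 - a - b"
  have c: "c < 5" "2 \<le> c" "c \<noteq> a" "c \<noteq> b" and abc: "\<And>i. i < 5 \<Longrightarrow> 2 \<le> i \<Longrightarrow> i = a \<or> i = b \<or> i = c"
    using five[OF a5] five[OF b(1)] a2 b2 ba by (auto simp: c_def dest!: five)
  have sq: "L b (q b) < 5" using latin_square_less[OF L] b less by simp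
  have Lp: "\<exists>i<5. L i (p i) = s" if "s < 5" for s
  proof -
    have "(\<lambda>i. L i (p i)) ` {..<5} = {..<5}"
      using sym(1) latin_square_less[OF L] less by (intro endo_inj_surj) auto
    then have "s \<in> (\<lambda>i. L i (p i)) ` {..<5}" using that by simp
    then show ?thesis by auto
  qed
  show False
  proof (cases "p c = q c")
    \<comment> \<open>Here \<open>p\<close> and \<open>q\<close> differ by exchanging the columns of
      rows \<open>a\<close> and \<open>b\<close>. Both use the same symbols, so the symbol of
      \<open>q\<close> in row \<open>b\<close> would be that of \<open>p\<close> in row
      \<open>a\<close> or \<open>b\<close>; it shares a column with the first cell and a row with
      the second.\<close>
    case True
    obtain i where i: "i < 5" "p i = q b" using surj[of "q b"] less b by auto
    have "i = a"
    proof -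
      have "2 \<le> i" using pq[of i] i b2 inj by (metis not_le)
      moreover have "i \<noteq> b" using i b inj ba by metis
      moreover have "i \<noteq> c" using i True inj c by metis
      ultimately show ?thesis using abc i(1) by blast
    qed
    then have qb: "q b = p a" using i by simp
    obtain k where k: "k < 5" "L k (p k) = L b (q b)" using Lp[OF sq] by auto
    have "2 \<le> k" using pq[of k] k b b2 symq[of k b] by (metis not_le)
    moreover have "k \<noteq> c" using True k b c symq[of c b] by metis
    moreover have "k \<noteq> b" using latin_square_row_inject[OF L b(1), of "p b" "p a"] k qb less a5 b(1) inj ba by metis
    moreover have "k \<noteq> a" using latin_square_column_inject[OF L a5 b(1), of "p a"] k qb less a5 ba by metis
    ultimately show False using abc k(1) by blast
  next
    case False
    have rows: "\<exists>j<5. L i j = s" and cols: "\<exists>j<5. L j i = s" if "i < 5" "s < 5" for i s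
    proof -
      have "L i ` {..<5} = {..<5}" "(\<lambda>j. L j i) ` {..<5} = {..<5}"
        using L that(1) unfolding latin_square_def bij_betw_def by (auto simp: eta_contract_eq)
      then have "s \<in> L i ` {..<5}" "s \<in> (\<lambda>j. L j i) ` {..<5}" using that by simp_all
      then show "\<exists>j<5. L i j = s" "\<exists>j<5. L j i = s" by auto
    qed
    have s: "L 0 (p 0) < 5" "L 1 (p 1) < 5" using latin_square_less[OF L] less by auto
    obtain j0 j1 where j0: "j0 < 5" "L 1 j0 = L 0 (p 0)" and j1: "j1 < 5" "L 0 j1 = L 1 (p 1)"
      using rows[of 1 "L 0 (p 0)"] rows[of 0 "L 1 (p 1)"] s by auto
    \<comment> \<open>Now \<open>p\<close> and \<open>q\<close> disagree in all three rows. One of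
      the three columns \<open>p a\<close>, \<open>p b\<close>, \<open>p c\<close> avoids both
      \<open>j0\<close> and \<open>j1\<close>.\<close>
    have "\<exists>x\<in>{a, b, c}. p x \<noteq> j0 \<and> p x \<noteq> j1"
      using inj(1)[of a b] inj(1)[of a c] inj(1)[of b c] ba c(3,4) by auto
    then obtain x where x: "x < 5" "2 \<le> x" "p x \<noteq> j0" "p x \<noteq> j1" "x = a \<or> x = b \<or> x = c"
      using a5 a2 b b2 c by auto
    have "p b \<noteq> q b" using b ba inj by simp
    then have xq: "p x \<noteq> q x" using x(5) a False by auto
    have px: "p x < 5" using less x by simp
    obtain y where y: "y < 5" "q y = p x" using surj px by auto
    have y2: "2 \<le> y" using pq[of y] x y xq inj by (metis not_le)
    \<comment> \<open>In column \<open>p x\<close> the two symbols used in rows 0 and 1 must occur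
      somewhere. Rows 0 and 1 are excluded by the choice of \<open>x\<close>, row \<open>x\<close>
      by \<open>p\<close> and row \<open>y\<close> by \<open>q\<close>; a single row remains for two
      different symbols.\<close>
    obtain z0 z1 where z0: "z0 < 5" "L z0 (p x) = L 0 (p 0)" and z1: "z1 < 5" "L z1 (p x) = L 1 (p 1)"
      using cols[OF px s(1)] cols[OF px s(2)] by auto
    have "z0 \<noteq> 0" using latin_square_row_inject[OF L, of 0 "p x" "p 0"] z0 px less x inj by (cases "z0 = 0") auto
    moreover have "z0 \<noteq> 1" using latin_square_row_inject[OF L, of 1 "p x" j0] z0 j0 px x by auto
    moreover have "z1 \<noteq> 1" using latin_square_row_inject[OF L, of 1 "p x" "p 1"] z1 px less x inj by auto
    moreover have "z1 \<noteq> 0" using latin_square_row_inject[OF L, of 0 "p x" j1] z1 j1 px x by (cases "z1 = 0") auto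
    moreover have "z0 \<noteq> x" using symp[of x 0] z0 x by auto
    moreover have "z1 \<noteq> x" using symp[of x 1] z1 x by auto
    moreover have "z0 \<noteq> y" using symq[of y 0] z0 y y2 pq[of 0] by auto
    moreover have "z1 \<noteq> y" using symq[of y 1] z1 y y2 pq[of 1] by auto
    moreover have "z0 \<noteq> z1" using symp[of 0 1] z0 z1 by auto
    moreover have "x \<noteq> y" using xq y by auto
    ultimately show False
      using x(1,2) y(1) y2 z0(1) z1(1) by (auto dest!: five)
  qed
qed

text \<open>The product bound is 25 here, above the claimed value of about 23.3. Instead, the
  columns in rows 0 and 1 are distinct and determine the transversal, which leaves
  \<open>5 * 4\<close> possibilities.\<close>

lemma T_5_le: "T 5 \<le> 20"
proof -
  obtain L where L: "latin_square 5 L" "T 5 = card (tperms 5 L)" using T_attained by blast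
  have "inj_on (\<lambda>p. (p 0, p 1)) (tperms 5 L)"
    using tperms_5_eqI[OF L(1)] by (intro inj_onI) auto
  moreover have "(\<lambda>p. (p 0, p 1)) ` tperms 5 L \<subseteq> (SIGMA a:{..<5}. {..<5} - {a})"
    unfolding tperms_def by (auto simp: permutes_in_image[of _ "{..<5}", simplified] permutes_inj[THEN inj_eq])
  then have "card ((\<lambda>p. (p 0, p 1)) ` tperms 5 L) \<le> card (SIGMA a:{..<5::nat}. {..<5} - {a})"
    by (intro card_mono) auto
  ultimately show ?thesis using L(2) by (simp add: card_image)
qed

lemma T_upper:
  assumes "n \<ge> 5"
  shows "real (T n) \<le> transversal_base ^ n * sqrt (real n) * fact n"
proof (cases "n = 5")
  case True
  have "sqrt 5 \<ge> (223/100 :: real)"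
    by (rule real_le_rsqrt) (simp add: power2_eq_square)
  have "real (T n) \<le> 20" using T_5_le True by simp
  also have "\<dots> \<le> (61/100) ^ 5 * (223/100) * fact 5" 
    by (simp add: fact_numeral power_divide)
  also have "\<dots> \<le> transversal_base ^ 5 * sqrt 5 * fact 5"
    using transversal_base_ge \<open>sqrt 5 \<ge> _\<close> by (intro mult_right_mono mult_mono power_mono) auto
  finally show ?thesis unfolding True by simp
next
  case False
  then show ?thesis
    using assms T_le_transversal_bound[of n] transversal_bound_le[of n] by linarith
qed

section \<open>Prolongation and inflation\<close>

lemma bij_betw_lessThanI:
  assumes "\<And>s. s < n \<Longrightarrow> \<exists>i<n. f i = s"
  shows "bij_betw f {..<n} {..<n::nat}"
proof -
  have sub: "{..<n} \<subseteq> f ` {..<n}" using assms by (auto simp: image_iff Bex_def)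
  have "card (f ` {..<n}) \<le> card {..<n}" by (rule card_image_le) simp
  with sub have eq: "f ` {..<n} = {..<n}" by (metis card_seteq finite_imageI finite_lessThan)
  then show ?thesis by (simp add: bij_betw_def eq_card_imp_inj_on)
qed

lemma latin_squareI:
  assumes "\<And>i s. i < n \<Longrightarrow> s < n \<Longrightarrow> \<exists>j<n. L i j = s"
    and "\<And>j s. j < n \<Longrightarrow> s < n \<Longrightarrow> \<exists>i<n. L i j = s"
  shows "latin_square n L"
  unfolding latin_square_def using assms by (auto intro!: bij_betw_lessThanI)

lemma latin_square_row: 
  assumes "latin_square n L" "i < n" "s < n"
  obtains j where "j < n" "L i j = s"
proof -
  have "s \<in> (\<lambda>j. L i j) ` {..<n}"
    using assms unfolding latin_square_def bij_betw_def by simp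
  then show ?thesis using that by auto
qed

lemma latin_square_column: 
  assumes "latin_square n L" "j < n" "s < n"
  obtains i where "i < n" "L i j = s"
proof -
  have "s \<in> (\<lambda>i. L i j) ` {..<n}"
    using assms unfolding latin_square_def bij_betw_def by simp
  then show ?thesis using that by auto
qed

lemma tpermsI:
  assumes "\<And>j. j < n \<Longrightarrow> \<exists>i<n. p i = j" "\<And>s. s < n \<Longrightarrow> \<exists>i<n. L i (p i) = s" "\<And>i. i \<ge> n \<Longrightarrow> p i = i"
  shows "p \<in> tperms n L"
proof -
  have "p permutes {..<n}"
    using assms by (intro bij_imp_permutes bij_betw_lessThanI) auto
  moreover have "inj_on (\<lambda>i. L i (p i)) {..<n}"
    using assms(2) by (rule bij_betw_imp_inj_on[OF bij_betw_lessThanI])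
  ultimately show ?thesis unfolding tperms_def by simp
qed

lemma tperms_less: "p \<in> tperms n L \<Longrightarrow> p i < n \<longleftrightarrow> i < n"
  unfolding tperms_def using permutes_in_image[of p "{..<n}" i] by simp

lemma tperms_outside: "p \<in> tperms n L \<Longrightarrow> i \<ge> n \<Longrightarrow> p i = i"
  unfolding tperms_def using permutes_not_in[of p "{..<n}" i] by simp

lemma tperms_eqI:
  "p \<in> tperms n L \<Longrightarrow> q \<in> tperms n L' \<Longrightarrow> (\<And>i. i < n \<Longrightarrow> p i = q i) \<Longrightarrow> p = q"
  by (rule ext) (metis not_le tperms_outside)

lemma tperms_column:
  assumes "p \<in> tperms n L" "j < n"
  obtains i where "i < n" "p i = j"
proof -
  have "j \<in> p ` {..<n}" using assms unfolding tperms_def by (simp add: permutes_image)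
  then show ?thesis using that by auto
qed

lemma tperms_symbol:
  assumes "latin_square n L" "p \<in> tperms n L" "s < n"
  obtains i where "i < n" "L i (p i) = s"
proof -
  have "(\<lambda>i. L i (p i)) ` {..<n} = {..<n}"
    using assms tperms_less[OF assms(2)] latin_square_less[OF assms(1)]
    by (intro endo_inj_surj) (auto simp: tperms_def)
  then have "s \<in> (\<lambda>i. L i (p i)) ` {..<n}" using assms(3) by simp
  then show ?thesis using that by auto
qed

section \<open>Prolongation along disjoint transversals\<close>

definition disjoint_transversals :: "nat \<Rightarrow> (nat \<Rightarrow> nat \<Rightarrow> nat) \<Rightarrow> nat \<Rightarrow> (nat \<Rightarrow> nat \<Rightarrow> nat) \<Rightarrow> bool" where
  "disjoint_transversals n L t \<tau> \<longleftrightarrow>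
     (\<forall>a<t. \<tau> a \<in> tperms n L) \<and> (\<forall>a<t. \<forall>b<t. \<forall>i<n. \<tau> a i = \<tau> b i \<longrightarrow> a = b)"

text \<open>The cells of \<open>\<tau> a\<close> receive the new symbol \<open>n + a\<close>, and
  their old symbols are projected to row \<open>n + a\<close> and column \<open>n + a\<close>. The
  projection to the row starts from a column, hence the inverse of \<open>\<tau>\<close>. A shifted
  copy of \<open>M\<close> fills the corner.\<close>

definition prolongation ::
  "nat \<Rightarrow> (nat \<Rightarrow> nat \<Rightarrow> nat) \<Rightarrow> nat \<Rightarrow> (nat \<Rightarrow> nat \<Rightarrow> nat) \<Rightarrow> (nat \<Rightarrow> nat \<Rightarrow> nat) \<Rightarrow> nat \<Rightarrow> nat \<Rightarrow> nat" where
  "prolongation n L t \<tau> M i j =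
    (if i < n then
       if j < n then
         if \<exists>a<t. \<tau> a i = j then n + (THE a. a < t \<and> \<tau> a i = j) else L i j
       else L i (\<tau> (j - n) i)
     else if j < n then L (inv (\<tau> (i - n)) j) j
     else n + M (i - n) (j - n))"

context
  fixes n t L \<tau> M
  assumes L: "latin_square n L" and \<tau>: "disjoint_transversals n L t \<tau>" and M: "latin_square t M"
begin

lemma prolongation_simps:
  shows "i < n \<Longrightarrow> a < t \<Longrightarrow> prolongation n L t \<tau> M i (\<tau> a i) = n + a"
    and "i < n \<Longrightarrow> j < n \<Longrightarrow> \<forall>a<t. \<tau> a i \<noteq> j \<Longrightarrow> prolongation n L t \<tau> M i j = L i j"
    and "i < n \<Longrightarrow> prolongation n L t \<tau> M i (n + a) = L i (\<tau> a i)"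
    and "i < n \<Longrightarrow> a < t \<Longrightarrow> prolongation n L t \<tau> M (n + a) (\<tau> a i) = L i (\<tau> a i)"
    and "prolongation n L t \<tau> M (n + a) (n + b) = n + M a b"
proof -
  assume "i < n" "a < t"
  then have "\<tau> a \<in> tperms n L" using \<tau> unfolding disjoint_transversals_def by blast
  then have less: "\<tau> a i < n" and inv: "inv (\<tau> a) (\<tau> a i) = i"
    using \<open>i < n\<close> tperms_less unfolding tperms_def by (auto simp: permutes_inverses)
  \<comment> \<open>By disjointness only one of the transversals passes through the cell.\<close>
  have "(THE a'. a' < t \<and> \<tau> a' i = \<tau> a i) = a"
    using \<tau> \<open>i < n\<close> \<open>a < t\<close> unfolding disjoint_transversals_def by (intro the_equality) auto
  then show "prolongation n L t \<tau> M i (\<tau> a i) = n + a"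
    using \<open>i < n\<close> \<open>a < t\<close> less unfolding prolongation_def by auto
  show "prolongation n L t \<tau> M (n + a) (\<tau> a i) = L i (\<tau> a i)"
    using less inv by (simp add: prolongation_def)
qed (auto simp: prolongation_def)

text \<open>It suffices to find every symbol in every line. A displaced symbol reappears in the
  projection, a new symbol sits on its transversal, and a projected line contains all old symbols
  because \<open>\<tau> a\<close> is a transversal.\<close>

lemma latin_square_prolongation: "latin_square (n + t) (prolongation n L t \<tau> M)" (is "latin_square _ ?L")
proof (rule latin_squareI)
  have tp: "\<tau> a \<in> tperms n L" if "a < t" for a using \<tau> that unfolding disjoint_transversals_def by blast
  note [simp] = prolongation_simps
  have cases: "\<exists>j<n + t. P j" if "(\<exists>j<n. P j) \<or> (\<exists>a<t. P (n + a))" for P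
    using that by (metis add_less_cancel_left trans_less_add1)
  have split: thesis if "x < n + t" "x < n \<Longrightarrow> thesis" "\<And>a. a < t \<Longrightarrow> x = n + a \<Longrightarrow> thesis" for x thesis
    using that by (metis add_less_cancel_left le_Suc_ex not_le)
  fix i s assume i: "i < n + t" and s: "s < n + t"
  show "\<exists>j<n + t. ?L i j = s"
  proof (rule split[OF i]; rule split[OF s])
    assume "i < n" "s < n"
    then obtain j where j: "j < n" "L i j = s" using latin_square_row[OF L] by blast
    show ?thesis
    proof (cases "\<exists>a<t. \<tau> a i = j")
      case True
      then obtain a where "a < t" "\<tau> a i = j" by blast
      then show ?thesis using \<open>i < n\<close> j by (intro exI[of _ "n + a"]) simp
    qed (use \<open>i < n\<close> j in \<open>auto intro!: cases\<close>)
  next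
    fix a assume "i < n" "a < t" "s = n + a"
    then show ?thesis using tperms_less[OF tp[of a], of i] by (intro exI[of _ "\<tau> a i"]) simp
  next
    fix a assume "a < t" "i = n + a" "s < n"
    obtain k where "k < n" "L k (\<tau> a k) = s" using tperms_symbol[OF L tp[OF \<open>a < t\<close>] \<open>s < n\<close>] by blast
    then show ?thesis using \<open>a < t\<close> \<open>i = n + a\<close> tperms_less[OF tp[of a], of k]
      by (intro exI[of _ "\<tau> a k"]) simp
  next
    fix a b assume "a < t" "i = n + a" "b < t" "s = n + b"
    moreover obtain c where "c < t" "M a c = b" using latin_square_row[OF M \<open>a < t\<close> \<open>b < t\<close>] by blast
    ultimately show ?thesis by (intro exI[of _ "n + c"]) simp
  qed
  \<comment> \<open>From here on \<open>i\<close> is a column.\<close>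
  show "\<exists>k<n + t. ?L k i = s"
  proof (rule split[OF i]; rule split[OF s])
    assume "i < n" "s < n"
    then obtain j where j: "j < n" "L j i = s" using latin_square_column[OF L] by blast
    show ?thesis
    proof (cases "\<exists>a<t. \<tau> a j = i")
      case True
      then obtain a where a: "a < t" "\<tau> a j = i" by blast
      then show ?thesis using j prolongation_simps(4)[of j a] by (intro exI[of _ "n + a"]) simp
    qed (use \<open>i < n\<close> j in \<open>auto intro!: cases\<close>)
  next
    fix a assume "i < n" "a < t" "s = n + a"
    obtain k where "k < n" "\<tau> a k = i" using tperms_column[OF tp[OF \<open>a < t\<close>] \<open>i < n\<close>] by blast
    then show ?thesis using \<open>a < t\<close> \<open>s = n + a\<close> prolongation_simps(1)[of k a] by (intro exI[of _ k]) simp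
  next
    fix a assume "a < t" "i = n + a" "s < n"
    obtain k where "k < n" "L k (\<tau> a k) = s" using tperms_symbol[OF L tp[OF \<open>a < t\<close>] \<open>s < n\<close>] by blast
    then show ?thesis using \<open>a < t\<close> \<open>i = n + a\<close> by (intro exI[of _ k]) simp
  next
    fix a b assume "a < t" "i = n + a" "b < t" "s = n + b"
    moreover obtain c where "c < t" "M c a = b" using latin_square_column[OF M \<open>a < t\<close> \<open>b < t\<close>] by blast
    ultimately show ?thesis by (intro exI[of _ "n + c"]) simp
  qed
qed

text \<open>A transversal of \<open>L\<close> that avoids all displaced cells keeps its symbols, so
  it can be completed by any transversal of the corner.\<close>

lemma card_tperms_prolongation:
  assumes A: "A \<subseteq> tperms n L" and avoid: "\<And>p a i. p \<in> A \<Longrightarrow> a < t \<Longrightarrow> i < n \<Longrightarrow> p i \<noteq> \<tau> a i"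
  shows "card A * card (tperms t M) \<le> card (tperms (n + t) (prolongation n L t \<tau> M))"
proof -
  define join where "join = (\<lambda>(p, q) i. if i < n then p i else if i < n + t then n + q (i - n) else i)"
    for p q :: "nat \<Rightarrow> nat"
  have join: "i < n \<Longrightarrow> join (p, q) i = p i" "a < t \<Longrightarrow> join (p, q) (n + a) = n + q a"
    for p q i a unfolding join_def by auto
  have "join ` (A \<times> tperms t M) \<subseteq> tperms (n + t) (prolongation n L t \<tau> M)"
  proof clarify
    fix p q assume "p \<in> A" and q: "q \<in> tperms t M"
    then have p: "p \<in> tperms n L" using A by auto
    have ex: "\<exists>x<n + t. P x" if "x < n + t" "x < n \<Longrightarrow> \<exists>i<n. P i" "\<And>a. a < t \<Longrightarrow> x = n + a \<Longrightarrow> \<exists>b<t. P (n + b)"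
      for P x
    proof (cases "x < n")
      case False
      then have "\<exists>b<t. P (n + b)" using that(1) by (intro that(3)[of "x - n"]) auto
      then obtain b where "b < t" "P (n + b)" by blast
      then show ?thesis by (intro exI[of _ "n + b"]) simp
    qed (use that(2) in \<open>auto intro: trans_less_add1\<close>)
    show "join (p, q) \<in> tperms (n + t) (prolongation n L t \<tau> M)"
    proof (rule tpermsI)
      fix j assume "j < n + t"
      then show "\<exists>i<n + t. join (p, q) i = j"
        by (rule ex) (use tperms_column[OF p] tperms_column[OF q] join in \<open>metis, metis\<close>)
    next
      fix s assume "s < n + t"
      then show "\<exists>i<n + t. prolongation n L t \<tau> M i (join (p, q) i) = s"
      proof (rule ex)
        assume "s < n"
        then obtain i where i: "i < n" "L i (p i) = s" using tperms_symbol[OF L p] by blast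
        moreover have "\<forall>a<t. \<tau> a i \<noteq> p i" using avoid[OF \<open>p \<in> A\<close>] i(1) by metis
        ultimately show "\<exists>i<n. prolongation n L t \<tau> M i (join (p, q) i) = s"
          using prolongation_simps(2)[of i "p i"] tperms_less[OF p, of i] by (auto simp: join)
      next
        fix a assume "a < t" "s = n + a"
        then obtain b where "b < t" "M b (q b) = a" using tperms_symbol[OF M q] by blast
        then show "\<exists>b<t. prolongation n L t \<tau> M (n + b) (join (p, q) (n + b)) = s"
          using prolongation_simps(5) \<open>s = n + a\<close> by (auto simp: join)
      qed
    qed (auto simp: join_def)
  qed
  moreover have "inj_on join (A \<times> tperms t M)"
  proof (rule inj_onI, clarify)
    fix p q p' q'
    assume *: "p \<in> A" "q \<in> tperms t M" "p' \<in> A" "q' \<in> tperms t M" and eq: "join (p, q) = join (p', q')"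
    have "p = p'"
    proof (rule tperms_eqI)
      fix i assume "i < n" then show "p i = p' i" using join(1) eq by metis
    qed (use * A in auto)
    moreover have "q = q'"
    proof (rule tperms_eqI)
      fix i assume "i < t" then show "q i = q' i" using join(2) eq by (metis add_left_cancel)
    qed (use * in auto)
    ultimately show "p = p' \<and> q = q'" by simp
  qed
  ultimately have "card (A \<times> tperms t M) \<le> card (tperms (n + t) (prolongation n L t \<tau> M))"
    by (metis card_image card_mono finite_tperms)
  then show ?thesis by (simp add: card_cartesian_product)
qed

end

lemma T_prolongation:
  assumes L: "latin_square n L" and \<tau>: "disjoint_transversals n L t \<tau>"
    and A: "A \<subseteq> tperms n L" and avoid: "\<And>p a i. p \<in> A \<Longrightarrow> a < t \<Longrightarrow> i < n \<Longrightarrow> p i \<noteq> \<tau> a i"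
  shows "card A * T t \<le> T (n + t)"
proof -
  obtain M where M: "latin_square t M" "T t = card (tperms t M)" using T_attained by blast
  have "card A * card (tperms t M) \<le> card (tperms (n + t) (prolongation n L t \<tau> M))"
    using avoid by (rule card_tperms_prolongation[OF L \<tau> M(1) A])
  also have "\<dots> \<le> T (n + t)" by (rule T_ge[OF latin_square_prolongation[OF L \<tau> M(1)]])
  finally show ?thesis unfolding M(2) .
qed

section \<open>Inflation of a square by blocks\<close>

definition inflation ::
  "nat \<Rightarrow> (nat \<Rightarrow> nat \<Rightarrow> nat) \<Rightarrow> (nat \<Rightarrow> nat \<Rightarrow> nat \<Rightarrow> nat \<Rightarrow> nat) \<Rightarrow> nat \<Rightarrow> nat \<Rightarrow> nat" where
  "inflation m K B i j = m * K (i div m) (j div m) + B (i div m) (j div m) (i mod m) (j mod m)"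

definition block_perm :: "nat \<Rightarrow> nat \<Rightarrow> (nat \<Rightarrow> nat) \<Rightarrow> (nat \<Rightarrow> nat \<Rightarrow> nat) \<Rightarrow> nat \<Rightarrow> nat" where
  "block_perm k m P Q i = (if i < k * m then m * P (i div m) + Q (i div m) (i mod m) else i)"

lemma block_index:
  assumes "u < k" "x < (m::nat)"
  shows "m * u + x < k * m" "(m * u + x) div m = u" "(m * u + x) mod m = x"
proof -
  have "m * u + x < m * Suc u" using assms by simp
  also have "\<dots> \<le> m * k" using assms by (intro mult_le_mono2) simp
  finally show "m * u + x < k * m" by (simp add: mult.commute)
qed (use assms in auto)

lemma block_cases:
  assumes "i < k * (m::nat)"
  obtains u x where "u < k" "x < m" "i = m * u + x"
proof
  have "m > 0" using assms by (cases m) auto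
  then show "i mod m < m" by simp
  show "i div m < k" using assms by (simp add: less_mult_imp_div_less)
qed simp

lemma inflation_simp:
  "u < k \<Longrightarrow> v < k \<Longrightarrow> x < m \<Longrightarrow> y < m \<Longrightarrow>
     inflation m K B (m * u + x) (m * v + y) = m * K u v + B u v x y"
  by (simp add: inflation_def)

lemma block_perm_simp:
  "u < k \<Longrightarrow> x < m \<Longrightarrow> block_perm k m P Q (m * u + x) = m * P u + Q u x"
  using block_index[of u k x m] by (simp add: block_perm_def)

lemma latin_square_inflation:
  assumes K: "latin_square k K" and B: "\<And>u v. u < k \<Longrightarrow> v < k \<Longrightarrow> latin_square m (B u v)"
  shows "latin_square (k * m) (inflation m K B)"
proof (rule latin_squareI)
  fix i s assume "i < k * m" "s < k * m"
  then obtain u x w z where *: "u < k" "x < m" "i = m * u + x" "w < k" "z < m" "s = m * w + z"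
    by (metis block_cases)
  obtain v where v: "v < k" "K u v = w" using latin_square_row[OF K] * by metis
  obtain y where y: "y < m" "B u v x y = z" using latin_square_row[OF B] * v by metis
  show "\<exists>j<k * m. inflation m K B i j = s"
    using * v y inflation_simp[of u k v x m y] block_index(1) by (intro exI[of _ "m * v + y"]) simp
  obtain v where v: "v < k" "K v u = w" using latin_square_column[OF K] * by metis
  obtain y where y: "y < m" "B v u y x = z" using latin_square_column[OF B] * v by metis
  show "\<exists>j<k * m. inflation m K B j i = s"
    using * v y inflation_simp[of v k u y m x] block_index(1) by (intro exI[of _ "m * v + y"]) simp
qed

lemma block_perm_tperms:
  assumes K: "latin_square k K" and B: "\<And>u v. u < k \<Longrightarrow> v < k \<Longrightarrow> latin_square m (B u v)"
    and P: "P \<in> tperms k K" and Q: "\<And>u. u < k \<Longrightarrow> Q u \<in> tperms m (B u (P u))"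
  shows "block_perm k m P Q \<in> tperms (k * m) (inflation m K B)"
proof (rule tpermsI)
  fix j assume "j < k * m"
  then obtain v y where *: "v < k" "y < m" "j = m * v + y" by (metis block_cases)
  obtain u where u: "u < k" "P u = v" using tperms_column[OF P] * by metis
  obtain x where x: "x < m" "Q u x = y" using tperms_column[OF Q] * u by metis
  show "\<exists>i<k * m. block_perm k m P Q i = j"
    using * u x block_perm_simp[of u k x m P Q] block_index(1) by (intro exI[of _ "m * u + x"]) simp
next
  fix s assume "s < k * m"
  then obtain w z where *: "w < k" "z < m" "s = m * w + z" by (metis block_cases)
  obtain u where u: "u < k" "K u (P u) = w" using tperms_symbol[OF K P] * by metis
  have Pu: "P u < k" using tperms_less[OF P] u by simp
  obtain x where x: "x < m" "B u (P u) x (Q u x) = z"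
    using tperms_symbol[OF B[OF u(1) Pu] Q[OF u(1)]] * by metis
  have "Q u x < m" using tperms_less[OF Q[OF u(1)]] x by simp
  then show "\<exists>i<k * m. inflation m K B i (block_perm k m P Q i) = s"
    using * u x Pu block_perm_simp[of u k x m P Q] inflation_simp[of u k "P u" x m "Q u x"] block_index(1)
    by (intro exI[of _ "m * u + x"]) simp
qed (simp add: block_perm_def)

lemma block_perm_eqD:
  assumes eq: "block_perm k m P Q (m * u + x) = block_perm k m P' Q' (m * u + x)"
    and "u < k" "x < m" "Q u x < m" "Q' u x < m"
  shows "P u = P' u" "Q u x = Q' u x"
proof -
  have "m * P u + Q u x = m * P' u + Q' u x" using assms by (simp add: block_perm_simp)
  moreover have "(m * P u + Q u x) div m = P u" "(m * P' u + Q' u x) div m = P' u"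
    "(m * P u + Q u x) mod m = Q u x" "(m * P' u + Q' u x) mod m = Q' u x"
    using assms by auto
  ultimately show "P u = P' u" "Q u x = Q' u x" by metis+
qed

text \<open>
  Inflate the order \<open>k\<close> square by squares of order \<open>m\<close> and prolong it along \<open>t\<close> transversals lying over
  the first \<open>s\<close> transversals of \<open>K\<close>. The other \<open>r\<close> transversals of \<open>K\<close> then still lie under \<open>k\<close> intact
  blocks of order \<open>m\<close>, which avoid the new corner block of order \<open>t\<close>.
\<close>

lemma T_inflation_prolongation:
  assumes K: "latin_square k K" and \<rho>: "disjoint_transversals k K (s + r) \<rho>"
    and G: "latin_square m G" and \<tau>: "disjoint_transversals m G e \<tau>"
    and "t \<le> s * e" "k > 0" "m > 0"
  shows "r * T m ^ k * T t \<le> T (k * m + t)"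
proof -
  obtain M where M: "latin_square m M" "T m = card (tperms m M)" using T_attained by blast
  \<comment> \<open>Blocks under the first \<open>s\<close> transversals of \<open>K\<close> are
    copies of \<open>G\<close>, which has disjoint transversals to prolong along; all others are
    copies of \<open>M\<close>, which has the most transversals.\<close>
  define B where "B u v = (if \<exists>a<s. \<rho> a u = v then G else M)" for u v
  have B: "latin_square m (B u v)" for u v unfolding B_def using G M(1) by auto
  let ?L = "inflation m K B"
  \<comment> \<open>The index \<open>c\<close> encodes a pair: \<open>c div e\<close> selects a
    transversal of \<open>K\<close>, \<open>c mod e\<close> one of \<open>G\<close>, giving up to
    \<open>s * e\<close> disjoint transversals.\<close>
  define \<sigma> where "\<sigma> c = block_perm k m (\<rho> (c div e)) (\<lambda>_. \<tau> (c mod e))" for c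
  \<comment> \<open>One of the \<open>r\<close> spare transversals of \<open>K\<close>, and
    independently a transversal in each of its \<open>k\<close> blocks: \<open>r * T m ^ k\<close>
    choices in all.\<close>
  define A where "A = (\<lambda>(b, Q). block_perm k m (\<rho> (s + b)) Q) ` ({..<r} \<times> (\<Pi>\<^sub>E u\<in>{..<k}. tperms m M))"
  have \<rho>t: "\<rho> a \<in> tperms k K" if "a < s + r" for a
    using \<rho> that unfolding disjoint_transversals_def by blast
  have \<rho>d: "a = b" if "\<rho> a u = \<rho> b u" "a < s + r" "b < s + r" "u < k" for a b u
    using \<rho> that unfolding disjoint_transversals_def by blast
  have \<tau>t: "\<tau> a \<in> tperms m G" if "a < e" for a
    using \<tau> that unfolding disjoint_transversals_def by blast
  have \<tau>d: "a = b" if "\<tau> a u = \<tau> b u" "a < e" "b < e" "u < m" for a b u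
    using \<tau> that unfolding disjoint_transversals_def by blast
  have c: "c div e < s" "c mod e < e" if "c < t" for c
  proof -
    have "c < s * e" using that assms by simp
    then show "c div e < s" by (rule less_mult_imp_div_less)
    show "c mod e < e" using \<open>c < s * e\<close> by (cases "e = 0") auto
  qed
  have *: "disjoint_transversals (k * m) ?L t \<sigma>"
    unfolding disjoint_transversals_def
  proof (intro conjI allI impI)
    fix a assume "a < t"
    then have ae: "a div e < s" "a mod e < e" using c by auto
    then show "\<sigma> a \<in> tperms (k * m) ?L"
      unfolding \<sigma>_def using \<rho>t[of "a div e"] \<tau>t
      by (intro block_perm_tperms K B) (auto simp: B_def)
    fix b i assume "b < t" "i < k * m" and eq: "\<sigma> a i = \<sigma> b i"
    then have be: "b div e < s" "b mod e < e" using c by auto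
    obtain u x where i: "u < k" "x < m" "i = m * u + x" using \<open>i < k * m\<close> by (rule block_cases)
    have "\<rho> (a div e) u = \<rho> (b div e) u" "\<tau> (a mod e) x = \<tau> (b mod e) x"
      using block_perm_eqD[OF eq[unfolded \<sigma>_def i(3)] i(1,2)] i(2)
        tperms_less[OF \<tau>t[OF ae(2)]] tperms_less[OF \<tau>t[OF be(2)]] by auto
    then have "a div e = b div e" "a mod e = b mod e"
      using \<rho>d[of "a div e" u "b div e"] \<tau>d[of "a mod e" x "b mod e"] ae be i by auto
    then show "a = b" by (metis div_mult_mod_eq)
  qed
  have Alt: "A \<subseteq> tperms (k * m) ?L"
  proof
    fix p assume "p \<in> A"
    then obtain b Q where bQ: "b < r" "\<And>u. u < k \<Longrightarrow> Q u \<in> tperms m M" "p = block_perm k m (\<rho> (s + b)) Q"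
      unfolding A_def by (auto simp: PiE_iff)
    have "B u (\<rho> (s + b) u) = M" if "u < k" for u
      using \<rho>d[of _ u "s + b"] bQ(1) that unfolding B_def by force
    then show "p \<in> tperms (k * m) ?L"
      unfolding bQ(3) using bQ(1,2) by (intro block_perm_tperms K B \<rho>t) auto
  qed
  have avoid: "p i \<noteq> \<sigma> a i" if "p \<in> A" "a < t" "i < k * m" for p a i
  proof
    assume eq: "p i = \<sigma> a i"
    obtain b Q where bQ: "b < r" "\<And>u. u < k \<Longrightarrow> Q u \<in> tperms m M" "p = block_perm k m (\<rho> (s + b)) Q"
      using \<open>p \<in> A\<close> unfolding A_def by (auto simp: PiE_iff)
    obtain u x where i: "u < k" "x < m" "i = m * u + x" using \<open>i < k * m\<close> by (rule block_cases)
    have "\<rho> (s + b) u = \<rho> (a div e) u"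
      using block_perm_eqD(1)[OF eq[unfolded \<sigma>_def i(3) bQ(3)] i(1,2)] i(2)
        tperms_less[OF bQ(2)[OF i(1)]] tperms_less[OF \<tau>t[OF c(2)[OF \<open>a < t\<close>]]] by auto
    then show False using \<rho>d[of "s + b" u "a div e"] c(1)[OF \<open>a < t\<close>] bQ(1) i(1) by simp
  qed
  have "inj_on (\<lambda>(b, Q). block_perm k m (\<rho> (s + b)) Q) ({..<r} \<times> (\<Pi>\<^sub>E u\<in>{..<k}. tperms m M))"
  proof (rule inj_onI)
    fix z z' assume z: "z \<in> {..<r} \<times> (\<Pi>\<^sub>E u\<in>{..<k}. tperms m M)" "z' \<in> {..<r} \<times> (\<Pi>\<^sub>E u\<in>{..<k}. tperms m M)"
      and eqz: "(\<lambda>(b, Q). block_perm k m (\<rho> (s + b)) Q) z = (\<lambda>(b, Q). block_perm k m (\<rho> (s + b)) Q) z'"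
    obtain b Q b' Q' where zz: "z = (b, Q)" "z' = (b', Q')" by (cases z, cases z')
    have b: "b \<in> {..<r}" "b' \<in> {..<r}"
      and Q: "Q \<in> (\<Pi>\<^sub>E u\<in>{..<k}. tperms m M)" "Q' \<in> (\<Pi>\<^sub>E u\<in>{..<k}. tperms m M)"
      and eq: "block_perm k m (\<rho> (s + b)) Q = block_perm k m (\<rho> (s + b')) Q'"
      using z eqz unfolding zz by auto
    have Qt: "Q u \<in> tperms m M" "Q' u \<in> tperms m M" if "u < k" for u using Q that by auto
    have D: "\<rho> (s + b) u = \<rho> (s + b') u" "Q u x = Q' u x" if "u < k" "x < m" for u x
      using block_perm_eqD[OF fun_cong[OF eq] that] tperms_less[OF Qt(1)] tperms_less[OF Qt(2)] that by auto
    \<comment> \<open>Row 0 exists as \<open>k\<close> and \<open>m\<close> are positive, and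
      \<open>b\<close> can be read off there.\<close>
    have "b = b'" using \<rho>d[of "s + b" 0 "s + b'"] D(1)[of 0 0] b assms(6,7) by simp
    moreover have "Q = Q'"
    proof (rule PiE_ext[OF Q])
      fix u assume "u \<in> {..<k}"
      then show "Q u = Q' u" using Qt D(2) by (intro tperms_eqI[of _ m M]) auto
    qed
    ultimately show "z = z'" unfolding zz by simp
  qed
  then have "card A = r * T m ^ k"
    unfolding A_def M(2) by (simp add: card_image card_cartesian_product card_PiE)
  then show ?thesis
    using T_prolongation[OF latin_square_inflation[OF K B] * Alt] avoid by simp
qed

section \<open>Rotations of the cyclic square\<close>

lemma permutes_lessThanI:
  assumes "inj_on f {..<n}" "\<And>i. i < n \<Longrightarrow> f i < (n::nat)"
  shows "(\<lambda>i. if i < n then f i else i) permutes {..<n}"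
proof (rule bij_imp_permutes)
  have "bij_betw f {..<n} {..<n}"
    unfolding bij_betw_def using assms by (intro conjI endo_inj_surj) auto
  then show "bij_betw (\<lambda>i. if i < n then f i else i) {..<n} {..<n}"
    by (rule bij_betw_cong[THEN iffD1, rotated]) simp
qed auto

definition rotation :: "nat \<Rightarrow> nat \<Rightarrow> nat \<Rightarrow> nat" where
  "rotation n a x = (if x < n then (x + a) mod n else x)"

lemma rotation_permutes: "rotation n a permutes {..<n}"
  unfolding rotation_def using inj_on_add_mod[of a n]
  by (intro permutes_lessThanI) (simp_all add: add.commute)

text \<open>The symbol of \<open>rotation n a\<close> in row \<open>x\<close> is
  \<open>2 * x + a\<close> modulo \<open>n\<close>, and 2 is invertible modulo an odd
  \<open>n\<close>.\<close>

lemma disjoint_transversals_cyclic: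
  assumes "odd n"
  shows "disjoint_transversals n (cyclic n) n (rotation n)"
proof -
  have "rotation n a \<in> tperms n (cyclic n)" for a
  proof -
    have "inj_on (\<lambda>x. (x + rotation n a x) mod n) {..<n}"
    proof
      fix x y
      assume xy: "x \<in> {..<n}" "y \<in> {..<n}" "(x + rotation n a x) mod n = (y + rotation n a y) mod n"
      then have "[2 * x + a = 2 * y + a] (mod n)"
        by (simp add: rotation_def mod_simps cong_def mult_2 add.assoc)
      then have "[2 * x = 2 * y] (mod n)" by (simp only: cong_add_rcancel_nat)
      then have "[x = y] (mod n)" using assms by (simp add: cong_mult_lcancel_nat)
      then show "x = y" using xy by (simp add: cong_def)
    qed
    then show ?thesis using rotation_permutes unfolding tperms_def by simp
  qed
  moreover have "a = b" if "a < n" "b < n" "i < n" "rotation n a i = rotation n b i" for a b i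
    using inj_onD[OF inj_on_add_mod[of i n], of a b] that by (simp add: rotation_def)
  ultimately show ?thesis unfolding disjoint_transversals_def by blast
qed

section \<open>Small orders\<close>

text \<open>
  Every row is given as a list of admissible pairs of a column and a symbol; \<open>cs\<close> and \<open>ss\<close> are the
  columns and symbols already used.
\<close>

fun search :: "(nat \<times> nat) list list \<Rightarrow> nat list \<Rightarrow> nat list \<Rightarrow> nat list list" where
  "search [] cs ss = [[]]"
| "search (r # rs) cs ss =
     concat (map (\<lambda>(j, s). if j \<in> set cs \<or> s \<in> set ss then []
                        else map ((#) j) (search rs (j # cs) (s # ss))) r)"

text \<open>The predicate \<open>A\<close> prunes the search: forbidding cells can only lower the
  count, so the result remains a lower bound.\<close>

definition cells :: "nat \<Rightarrow> (nat \<Rightarrow> nat \<Rightarrow> nat) \<Rightarrow> (nat \<Rightarrow> nat \<Rightarrow> bool) \<Rightarrow> (nat \<times> nat) list list" where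
  "cells n L A = map (\<lambda>i. map (\<lambda>j. (j, L i j)) (filter (A i) [0..<n])) [0..<n]"

lemma search_sound:
  assumes "xs \<in> set (search rs cs ss)"
  shows "length xs = length rs \<and> distinct xs \<and> set xs \<inter> set cs = {} \<and>
    (\<exists>ys. length ys = length rs \<and> distinct ys \<and> set ys \<inter> set ss = {} \<and>
          (\<forall>i<length rs. (xs ! i, ys ! i) \<in> set (rs ! i)))"
  using assms
proof (induction rs arbitrary: xs cs ss)
  case (Cons r rs)
  then obtain j s zs where js: "(j, s) \<in> set r" "j \<notin> set cs" "s \<notin> set ss"
    and zs: "zs \<in> set (search rs (j # cs) (s # ss))" "xs = j # zs"
    by (auto split: if_splits)
  from Cons.IH[OF zs(1)] obtain ys where ys: "length ys = length rs" "distinct ys" "set ys \<inter> set (s # ss) = {}"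
    "\<forall>i<length rs. (zs ! i, ys ! i) \<in> set (rs ! i)"
    and zs': "length zs = length rs" "distinct zs" "set zs \<inter> set (j # cs) = {}"
    by auto
  show ?case
    using js ys zs' unfolding zs(2)
    by (intro conjI exI[of _ "s # ys"]) (auto simp: less_Suc_eq_0_disj)
qed simp

text \<open>This turns the length of the result into a cardinality. Lists arising from different
  entries of \<open>r\<close> already differ in their heads.\<close>

lemma distinct_search:
  assumes "\<forall>r\<in>set rs. distinct (map fst r)"
  shows "distinct (search rs cs ss)"
  using assms
proof (induction rs arbitrary: cs ss)
  case (Cons r rs)
  define F where "F = (\<lambda>(j, s). if j \<in> set cs \<or> s \<in> set ss then []
                        else map ((#) j) (search rs (j # cs) (s # ss)))"
  have F: "distinct (F z)" "\<forall>xs\<in>set (F z). xs \<noteq> [] \<and> hd xs = fst z" for z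
    unfolding F_def using Cons by (auto simp: distinct_map split: prod.split)
  have "distinct (concat (map F r'))" if "distinct (map fst r')" for r'
    using that
  proof (induction r')
    case (Cons z r')
    have False if "xs \<in> set (F z)" "z' \<in> set r'" "xs \<in> set (F z')" for xs z'
    proof -
      have "fst z = fst z'" using F(2) that by metis
      then show False using Cons.prems that(2) by auto
    qed
    then show ?case using Cons F(1) by auto
  qed simp
  then show ?case using Cons.prems unfolding F_def by simp
qed simp

lemma length_search_le:
  "length (search (cells n L A) [] []) \<le> card {p \<in> tperms n L. \<forall>i<n. A i (p i)}"
proof -
  let ?S = "search (cells n L A) [] []"
  define g where "g xs i = (if i < n then xs ! i else i)" for xs :: "nat list" and i
  have S: "length xs = n" "distinct xs" "\<forall>i<n. xs ! i < n \<and> A i (xs ! i)"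
    "inj_on (\<lambda>i. L i (xs ! i)) {..<n}" if xs: "xs \<in> set ?S" for xs
  proof -
    from search_sound[OF xs] obtain ys where *: "length xs = n" "distinct xs" "length ys = n" "distinct ys"
      "\<forall>i<n. (xs ! i, ys ! i) \<in> set (cells n L A ! i)" by (auto simp: cells_def)
    then have **: "xs ! i < n \<and> A i (xs ! i) \<and> ys ! i = L i (xs ! i)" if "i < n" for i
      using that by (auto simp: cells_def)
    show "length xs = n" "distinct xs" "\<forall>i<n. xs ! i < n \<and> A i (xs ! i)" using * ** by auto
    show "inj_on (\<lambda>i. L i (xs ! i)) {..<n}"
    proof
      fix i j assume ij: "i \<in> {..<n}" "j \<in> {..<n}" "L i (xs ! i) = L j (xs ! j)"
      then have "ys ! i = ys ! j" using ** by simp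
      then show "i = j" using ij *(3,4) by (simp add: nth_eq_iff_index_eq)
    qed
  qed
  have "g ` set ?S \<subseteq> {p \<in> tperms n L. \<forall>i<n. A i (p i)}"
  proof clarify
    fix xs assume xs: "xs \<in> set ?S"
    have "inj_on (\<lambda>i. xs ! i) {..<n}"
      using S(1,2)[OF xs] by (auto simp: inj_on_def nth_eq_iff_index_eq)
    then have "g xs permutes {..<n}"
      unfolding g_def using S(3)[OF xs] by (intro permutes_lessThanI) auto
    moreover have "inj_on (\<lambda>i. L i (g xs i)) {..<n}"
      using S(4)[OF xs] by (auto simp: g_def inj_on_def)
    ultimately show "g xs \<in> tperms n L \<and> (\<forall>i<n. A i (g xs i))"
      using S(3)[OF xs] by (simp add: tperms_def g_def)
  qed
  moreover have "inj_on g (set ?S)"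
  proof
    fix xs ys assume xy: "xs \<in> set ?S" "ys \<in> set ?S" "g xs = g ys"
    then have "xs ! i = ys ! i" if "i < n" for i using that by (metis g_def)
    then show "xs = ys" using S(1) xy by (intro nth_equalityI) auto
  qed
  ultimately have "card (set ?S) \<le> card {p \<in> tperms n L. \<forall>i<n. A i (p i)}"
    by (intro card_inj_on_le[of g]) auto
  moreover have "distinct ?S"
    by (rule distinct_search) (auto simp: cells_def comp_def)
  ultimately show ?thesis by (simp add: distinct_card)
qed

corollary length_search_le_T:
  assumes "latin_square n L"
  shows "length (search (cells n L A) [] []) \<le> T n"
proof -
  have "card {p \<in> tperms n L. \<forall>i<n. A i (p i)} \<le> card (tperms n L)"
    by (intro card_mono) auto
  then show ?thesis using length_search_le[of n L A] T_ge[OF assms] by linarith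
qed

text \<open>
  Avoiding the transversal \<open>i \<mapsto> i + 1\<close> makes these permutations survive in the prolongation of order
  \<open>n + 1\<close> along it.
\<close>

definition one_fixed_point :: "nat \<Rightarrow> (nat \<Rightarrow> nat) set" where
  "one_fixed_point n = {p \<in> tperms n (cyclic n). \<forall>i<n. p i \<noteq> (i + 1) mod n \<and> (p i = i \<longleftrightarrow> i = 0)}"

definition shifted :: "nat \<Rightarrow> nat \<Rightarrow> (nat \<Rightarrow> nat) \<Rightarrow> nat \<Rightarrow> nat" where
  "shifted n a p = rotation n a \<circ> p \<circ> inv (rotation n a)"

lemma shifted_rotation: "shifted n a p (rotation n a x) = rotation n a (p x)"
  by (simp add: shifted_def permutes_inverses[OF rotation_permutes])

lemma rotation_surj:
  assumes "i < n" obtains x where "x < n" "i = rotation n a x"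
proof -
  have "i \<in> rotation n a ` {..<n}" using assms permutes_image[OF rotation_permutes] by simp
  then show ?thesis using that by auto
qed

text \<open>Conjugation by a rotation translates rows and columns by \<open>a\<close>, hence all
  symbols by \<open>2 * a\<close>, so they stay distinct.\<close>

lemma shifted_tperms:
  assumes p: "p \<in> tperms n (cyclic n)"
  shows "shifted n a p \<in> tperms n (cyclic n)"
proof -
  have pp: "p permutes {..<n}" and inj: "inj_on (\<lambda>i. (i + p i) mod n) {..<n}"
    using p unfolding tperms_def by auto
  have "shifted n a p permutes {..<n}"
    unfolding shifted_def by (intro permutes_compose permutes_inv rotation_permutes pp)
  moreover have "inj_on (\<lambda>i. (i + shifted n a p i) mod n) {..<n}"
  proof
    fix i j assume ij: "i \<in> {..<n}" "j \<in> {..<n}" "(i + shifted n a p i) mod n = (j + shifted n a p j) mod n"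
    obtain x y where xy: "x < n" "i = rotation n a x" "y < n" "j = rotation n a y"
      using ij rotation_surj by (metis lessThan_iff)
    have px: "p x < n" "p y < n" using tperms_less[OF p] xy by auto
    have "((x + a) + (p x + a)) mod n = ((y + a) + (p y + a)) mod n"
      using ij(3) px xy unfolding xy(2,4) shifted_rotation by (simp add: rotation_def mod_simps)
    then have "[(x + p x) + 2 * a = (y + p y) + 2 * a] (mod n)"
      by (simp add: cong_def mult_2 add_ac)
    then have "[x + p x = y + p y] (mod n)" by (simp only: cong_add_rcancel_nat)
    then have "x = y" using inj_onD[OF inj, of x y] xy by (simp add: cong_def)
    then show "i = j" using xy by simp
  qed
  ultimately show ?thesis unfolding tperms_def by simp
qed

text \<open>The shift \<open>a\<close> can be read off the shifted permutation, as its only fixed point.\<close>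

lemma card_one_fixed_point:
  assumes "n \<ge> 2"
  shows "n * card (one_fixed_point n)
       \<le> card {p \<in> tperms n (cyclic n). \<forall>i<n. p i \<noteq> (i + 1) mod n}"
proof -
  define f where "f = (\<lambda>(a, p). shifted n a p)"
  have fin: "finite (one_fixed_point n)" unfolding one_fixed_point_def by simp
  have rot_eq: "rotation n a x = rotation n a y \<longleftrightarrow> x = y" for a x y
    using permutes_inj[OF rotation_permutes] by (simp add: inj_eq)
  have less: "p x < n" if "p \<in> one_fixed_point n" "x < n" for p x
    using that tperms_less unfolding one_fixed_point_def by blast
  have "f ` ({..<n} \<times> one_fixed_point n) \<subseteq> {p \<in> tperms n (cyclic n). \<forall>i<n. p i \<noteq> (i + 1) mod n}"
  proof
    fix q assume "q \<in> f ` ({..<n} \<times> one_fixed_point n)"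
    then obtain a p where q: "q = f (a, p)" and p: "p \<in> one_fixed_point n" by auto
    \<comment> \<open>The map sending \<open>i\<close> to \<open>i + 1\<close> commutes with
      rotations, so avoiding it survives conjugation.\<close>
    have "shifted n a p i \<noteq> (i + 1) mod n" if "i < n" for i
    proof
      assume eq: "shifted n a p i = (i + 1) mod n"
      obtain x where x: "x < n" "i = rotation n a x" using rotation_surj \<open>i < n\<close> by blast
      have "rotation n a (p x) = rotation n a ((x + 1) mod n)"
        using eq x less[OF p, of x] unfolding x(2) shifted_rotation
        by (simp add: rotation_def mod_simps add_ac)
      then show False using p x(1) unfolding rot_eq one_fixed_point_def by auto
    qed
    moreover have "shifted n a p \<in> tperms n (cyclic n)"
      using p shifted_tperms unfolding one_fixed_point_def by blast
    ultimately show "q \<in> {p \<in> tperms n (cyclic n). \<forall>i<n. p i \<noteq> (i + 1) mod n}"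
      unfolding q f_def by simp
  qed
  moreover have "inj_on f ({..<n} \<times> one_fixed_point n)"
  proof (rule inj_onI)
    fix z z' assume z: "z \<in> {..<n} \<times> one_fixed_point n" "z' \<in> {..<n} \<times> one_fixed_point n" "f z = f z'"
    obtain a p b q where zz: "z = (a, p)" "z' = (b, q)" by (cases z, cases z')
    have a: "a \<in> {..<n}" and b: "b \<in> {..<n}" and p: "p \<in> one_fixed_point n" and q: "q \<in> one_fixed_point n"
      and "f (a, p) = f (b, q)"
      using z unfolding zz by auto
    then have eq: "shifted n a p = shifted n b q" unfolding f_def by simp
    have r0: "rotation n a 0 = a" "rotation n b 0 = b" using a b by (simp_all add: rotation_def)
    obtain y where y: "y < n" "a = rotation n b y" using rotation_surj a by (metis lessThan_iff)
    have "0 < n" using assms by simp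
    then have "p 0 = 0" using p unfolding one_fixed_point_def by blast
    then have "shifted n a p a = a" using shifted_rotation[of n a p 0] r0 by simp
    then have "rotation n b (q y) = rotation n b y"
      using eq shifted_rotation[of n b q y] y by simp
    then have "y = 0" using q y(1) unfolding rot_eq one_fixed_point_def by simp
    then have ab: "a = b" using y r0 by simp
    have "p x = q x" for x
      using shifted_rotation[of n a p x] shifted_rotation[of n a q x] eq rot_eq unfolding ab by simp
    then show "z = z'" unfolding zz using ab by auto
  qed
  ultimately have "card ({..<n} \<times> one_fixed_point n)
      \<le> card {p \<in> tperms n (cyclic n). \<forall>i<n. p i \<noteq> (i + 1) mod n}"
    by (intro card_inj_on_le[of f]) auto
  then show ?thesis by (simp add: card_cartesian_product)
qed

lemma T_1_ge: "1 \<le> T 1"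
proof -
  have "id \<in> tperms 1 (cyclic 1)" by (auto intro: tpermsI)
  then have "0 < card (tperms 1 (cyclic 1))" by (auto simp: card_gt_0_iff)
  then show ?thesis using T_ge[OF latin_square_cyclic[of 1]] by linarith
qed

lemma T_ge_one_fixed_point:
  assumes "odd n" "n \<ge> 2" "c \<le> card (one_fixed_point n)"
  shows "n * c \<le> T n" "n * c \<le> T (n + 1)"
proof -
  let ?A = "{p \<in> tperms n (cyclic n). \<forall>i<n. p i \<noteq> (i + 1) mod n}"
  have "n * c \<le> n * card (one_fixed_point n)" using assms(3) by simp
  then have c: "n * c \<le> card ?A" using card_one_fixed_point[OF assms(2)] by linarith
  have "card ?A \<le> card (tperms n (cyclic n))" by (intro card_mono) auto
  then show "n * c \<le> T n" using c T_ge[OF latin_square_cyclic[of n]] by linarith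
  have "disjoint_transversals n (cyclic n) 1 (\<lambda>_. rotation n 1)"
    using disjoint_transversals_cyclic[OF assms(1)] assms(2) unfolding disjoint_transversals_def by auto
  then have "card ?A * T 1 \<le> T (n + 1)"
    by (rule T_prolongation[OF latin_square_cyclic]) (auto simp: rotation_def)
  moreover have "card ?A * 1 \<le> card ?A * T 1" using T_1_ge by (intro mult_le_mono2)
  ultimately show "n * c \<le> T (n + 1)" using c by linarith
qed

lemma length_search_le_one_fixed_point:
  assumes "\<And>i j. A i j \<Longrightarrow> j \<noteq> (i + 1) mod n \<and> (j = i \<longleftrightarrow> i = 0)"
  shows "length (search (cells n (cyclic n) A) [] []) \<le> card (one_fixed_point n)"
  using assms unfolding one_fixed_point_def
  by (intro order_trans[OF length_search_le] card_mono) auto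

text \<open>Of the three rotations of the cyclic square of order 3, two carry the
  \<open>2 * m\<close> disjoint transversals for the prolongation and the third carries three intact
  blocks of order \<open>m\<close>.\<close>

lemma T_triple_add:
  assumes "odd m" "t \<le> 2 * m"
  shows "T m ^ 3 * T t \<le> T (3 * m + t)"
proof -
  have "m > 0" using assms(1) by (cases m) auto
  moreover have "disjoint_transversals 3 (cyclic 3) (2 + 1) (rotation 3)"
    using disjoint_transversals_cyclic[of 3] by simp
  ultimately have "1 * T m ^ 3 * T t \<le> T (3 * m + t)"
    using disjoint_transversals_cyclic[OF assms(1)] assms(2)
    by (intro T_inflation_prolongation[where s = 2]) (auto simp: latin_square_cyclic)
  then show ?thesis by simp
qed

lemma T_0_ge: "1 \<le> T 0"
proof -
  have "id \<in> tperms 0 (cyclic 0)" by (auto intro: tpermsI)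
  then have "0 < card (tperms 0 (cyclic 0))" by (auto simp: card_gt_0_iff)
  then show ?thesis using T_ge[OF latin_square_cyclic[of 0]] by linarith
qed

text \<open>Without prolongation the blocks require no disjoint transversals, so \<open>m\<close>
  may be even, and all three rotations count. Used for orders 15 and 18.\<close>

lemma T_triple:
  assumes "m > 0"
  shows "3 * T m ^ 3 \<le> T (3 * m)"
proof -
  have "disjoint_transversals 3 (cyclic 3) (0 + 3) (rotation 3)"
    using disjoint_transversals_cyclic[of 3] by simp
  moreover have "disjoint_transversals m (cyclic m) 0 (rotation m)"
    by (simp add: disjoint_transversals_def)
  ultimately have "3 * T m ^ 3 * T 0 \<le> T (3 * m + 0)"
    using assms by (intro T_inflation_prolongation[where s = 0]) (auto simp: latin_square_cyclic)
  with mult_le_mono2[OF T_0_ge, of "3 * T m ^ 3"] have "3 * T m ^ 3 * 1 \<le> T (3 * m + 0)"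
    by (rule order_trans)
  then show ?thesis by simp
qed

section \<open>Explicit squares and counts by search\<close>

definition table :: "nat list list \<Rightarrow> nat \<Rightarrow> nat \<Rightarrow> nat" where
  "table xss i j = xss ! i ! j"

lemma latin_square_table:
  assumes "length xss = n"
    "\<forall>xs\<in>set xss. length xs = n \<and> distinct xs \<and> (\<forall>x\<in>set xs. x < n)"
    "\<forall>j\<in>set [0..<n]. distinct (map (\<lambda>xs. xs ! j) xss)"
  shows "latin_square n (table xss)"
  unfolding latin_square_iff table_def
proof (intro conjI allI impI)
  fix i j assume ij: "i < n" "j < n"
  have x: "xss ! i \<in> set xss" "length (xss ! i) = n" using ij assms by auto
  then show "xss ! i ! j < n" using assms(2) ij by (metis nth_mem)
next
  fix i assume "i < n"
  then have "length (xss ! i) = n \<and> distinct (xss ! i)" using assms by simp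
  then show "inj_on (\<lambda>j. xss ! i ! j) {..<n}" by (auto simp: inj_on_def nth_eq_iff_index_eq)
next
  fix j assume "j < n"
  then have "distinct (map (\<lambda>xs. xs ! j) xss)" using assms(3) by simp
  then show "inj_on (\<lambda>i. xss ! i ! j) {..<n}"
    using assms(1) by (auto simp: inj_on_def distinct_conv_nth)
qed

text \<open>The Cayley table of the Klein four-group; the cyclic square of order 4 has no
  transversal.\<close>

definition klein :: "nat \<Rightarrow> nat \<Rightarrow> nat" where
  "klein = table [[0,1,2,3], [1,0,3,2], [2,3,0,1], [3,2,1,0]]"

lemma latin_square_klein: "latin_square 4 klein"
  unfolding klein_def by (rule latin_square_table; code_simp)

text \<open>The maps \<open>x \<mapsto> \<omega> x + a\<close> over the field with four elements.\<close>

definition klein_transversal :: "nat \<Rightarrow> nat \<Rightarrow> nat" where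
  "klein_transversal a i =
     (if i < 4 then table [[0,2,3,1], [1,3,2,0], [2,0,1,3], [3,1,0,2]] a i else i)"

lemma disjoint_transversals_klein: "disjoint_transversals 4 klein 4 klein_transversal"
proof -
  have "klein_transversal a \<in> tperms 4 klein" if "a < 4" for a
  proof (rule tpermsI)
    have "\<forall>a\<in>set [0..<4]. \<forall>j\<in>set [0..<4]. \<exists>i\<in>set [0..<4]. klein_transversal a i = j"
      "\<forall>a\<in>set [0..<4]. \<forall>j\<in>set [0..<4]. \<exists>i\<in>set [0..<4]. klein i (klein_transversal a i) = j"
      by code_simp+
    moreover have "a \<in> set [0..<4]" using that by simp
    ultimately have "\<forall>j\<in>set [0..<4]. \<exists>i\<in>set [0..<4]. klein_transversal a i = j"
      "\<forall>j\<in>set [0..<4]. \<exists>i\<in>set [0..<4]. klein i (klein_transversal a i) = j"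
      by blast+
    then show "\<exists>i<4. klein_transversal a i = j" "\<exists>i<4. klein i (klein_transversal a i) = j" if "j < 4" for j
      using that by (simp_all add: Ball_def Bex_def)
  qed (simp add: klein_transversal_def)
  moreover have "a = b"
    if "a < 4" "b < 4" "i < 4" "klein_transversal a i = klein_transversal b i" for a b i
  proof -
    have "\<forall>a\<in>set [0..<4]. \<forall>b\<in>set [0..<4]. \<forall>i\<in>set [0..<4].
        klein_transversal a i = klein_transversal b i \<longrightarrow> a = b"
      by code_simp
    moreover have "a \<in> set [0..<4]" "b \<in> set [0..<4]" "i \<in> set [0..<4]" using that by simp_all
    ultimately show ?thesis using that(4) by blast
  qed
  ultimately show ?thesis unfolding disjoint_transversals_def by blast
qed

lemma T_4_ge: "8 \<le> T 4"
proof -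
  have "length (search (cells 4 klein (\<lambda>_ _. True)) [] []) = 8" by code_simp
  then show ?thesis using length_search_le_T[OF latin_square_klein] by metis
qed

lemma T_5_ge: "15 \<le> T 5"
proof -
  have "length (search (cells 5 (cyclic 5) (\<lambda>_ _. True)) [] []) = 15" by code_simp
  then show ?thesis using length_search_le_T[OF latin_square_cyclic] by metis
qed

lemma T_6_ge: "32 \<le> T 6"
proof -
  \<comment> \<open>The cyclic square fails for even orders. At least 26 transversals are required,
    since \<open>15 powr (6/5)\<close> is about 25.8.\<close>
  let ?L = "table [[1,2,0,4,3,5], [3,5,2,1,4,0], [5,3,1,2,0,4], [2,1,4,0,5,3], [0,4,5,3,2,1], [4,0,3,5,1,2]]"
  have "latin_square 6 ?L" by (rule latin_square_table; code_simp)
  moreover have "length (search (cells 6 ?L (\<lambda>_ _. True)) [] []) = 32" by code_simp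
  ultimately show ?thesis using length_search_le_T by metis
qed

lemma T_7_ge: "133 \<le> T 7"
proof -
  have "length (search (cells 7 (cyclic 7) (\<lambda>_ _. True)) [] []) = 133" by code_simp
  then show ?thesis using length_search_le_T[OF latin_square_cyclic] by metis
qed

lemma T_8_ge: "96 \<le> T 8"
proof -
  let ?L = "table [[0,1,2,3,4,5,6,7], [1,0,3,2,5,4,7,6], [2,3,0,1,6,7,4,5], [3,2,1,0,7,6,5,4],
                   [4,5,6,7,0,1,2,3], [5,4,7,6,1,0,3,2], [6,7,4,5,2,3,0,1], [7,6,5,4,3,2,1,0]]"
  have "latin_square 8 ?L" by (rule latin_square_table; code_simp)
  \<comment> \<open>By translation each column in row 0 accounts for 48 transversals, so two columns
    suffice to pass \<open>15 powr (8/5)\<close>, about 76.2.\<close>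
  moreover have "length (search (cells 8 ?L (\<lambda>i j. 0 < i \<or> j < 2)) [] []) = 96" by code_simp
  ultimately show ?thesis using length_search_le_T by metis
qed

text \<open>One search serves two orders: \<open>9 * 26 = 234\<close> exceeds \<open>15 ^ 2\<close>,
  the value required at order 10.\<close>

lemma T_ge_from_9: "234 \<le> T 9" "234 \<le> T 10"
proof -
  have "length (search (cells 9 (cyclic 9) (\<lambda>i j. j \<noteq> (i + 1) mod 9 \<and> (j = i \<longleftrightarrow> i = 0))) [] []) = 26"
    by code_simp
  then have "26 \<le> card (one_fixed_point 9)"
    using length_search_le_one_fixed_point[of "\<lambda>i j. j \<noteq> (i + 1) mod 9 \<and> (j = i \<longleftrightarrow> i = 0)" 9] by simp
  then show "234 \<le> T 9" "234 \<le> T 10" using T_ge_one_fixed_point[of 9 26] by simp_all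
qed

lemma T_ge_from_11: "847 \<le> T 11" "847 \<le> T 12"
proof -
  \<comment> \<open>The restriction of row 1 shortens the search; \<open>11 * 77 = 847\<close> still
    exceeds \<open>15 powr (12/5)\<close>, about 665.\<close>
  let ?A = "\<lambda>i j. j \<noteq> (i + 1) mod 11 \<and> (j = i \<longleftrightarrow> i = 0) \<and> (i = 1 \<longrightarrow> j = 8 \<or> j = 10)"
  have "length (search (cells 11 (cyclic 11) ?A) [] []) = 77"
    by code_simp
  then have "77 \<le> card (one_fixed_point 11)"
    using length_search_le_one_fixed_point[of ?A 11] by simp
  then show "847 \<le> T 11" "847 \<le> T 12" using T_ge_one_fixed_point[of 11 77] by simp_all
qed

text \<open>The conditions on rows 1 to 3 only keep the search small.\<close>

lemma T_ge_from_13: "2197 \<le> T 13" "2197 \<le> T 14"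
proof -
  let ?A = "\<lambda>i j. j \<noteq> (i + 1) mod 13 \<and> (j = i \<longleftrightarrow> i = 0) \<and> (i = 1 \<longrightarrow> j = 10) \<and>
    (i = 2 \<longrightarrow> j = 6 \<or> j = 7 \<or> j = 8) \<and> (i = 3 \<longrightarrow> j = 9 \<or> j = 11)"
  have "length (search (cells 13 (cyclic 13) ?A) [] []) = 169"
    by code_simp
  then have "169 \<le> card (one_fixed_point 13)"
    using length_search_le_one_fixed_point[of ?A 13] by simp
  then show "2197 \<le> T 13" "2197 \<le> T 14" using T_ge_one_fixed_point[of 13 169] by simp_all
qed

text \<open>The Klein square inflated by itself: \<open>s\<close> of its four disjoint transversals
  serve the prolongation, and each of \<open>r\<close> others carries four blocks with at least 8
  transversals.\<close>

lemma T_klein_ge: "r + s \<le> 4 \<Longrightarrow> t \<le> 4 * s \<Longrightarrow> r * 8 ^ 4 * T t \<le> T (16 + t)"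
proof -
  assume rs: "r + s \<le> 4" and t: "t \<le> 4 * s"
  have "disjoint_transversals 4 klein (s + r) klein_transversal"
    using disjoint_transversals_klein rs unfolding disjoint_transversals_def by auto
  then have "r * T 4 ^ 4 * T t \<le> T (4 * 4 + t)"
    using t by (intro T_inflation_prolongation[where s = s and G = klein and e = 4 and \<tau> = klein_transversal
          and \<rho> = klein_transversal]) (auto simp: latin_square_klein disjoint_transversals_klein)
  moreover have "r * 8 ^ 4 * T t \<le> r * T 4 ^ 4 * T t"
    using T_4_ge by (intro mult_le_mono power_mono) auto
  ultimately have "r * 8 ^ 4 * T t \<le> T (4 * 4 + t)" by (rule order_trans[rotated])
  then show ?thesis by simp
qed

text \<open>Order 19 is split as \<open>3 * 4 + 7\<close>, with the Klein square in place of an odd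
  cyclic one. The split \<open>3 * 5 + 4\<close> would only give \<open>15 ^ 3 * 8 = 27000\<close>
  from the bounds at hand, below \<open>15 powr (19/5)\<close>.\<close>

lemma T_19_ge: "512 * 133 \<le> T 19"
proof -
  have "disjoint_transversals 3 (cyclic 3) (2 + 1) (rotation 3)"
    using disjoint_transversals_cyclic[of 3] by simp
  then have "1 * T 4 ^ 3 * T 7 \<le> T (3 * 4 + 7)"
    by (intro T_inflation_prolongation[where s = 2 and G = klein and e = 4 and \<tau> = klein_transversal])
      (auto simp: latin_square_cyclic latin_square_klein disjoint_transversals_klein)
  moreover have "8 ^ 3 * 133 \<le> T 4 ^ 3 * T 7"
    using T_4_ge T_7_ge by (intro mult_le_mono power_mono) auto
  ultimately show ?thesis by simp
qed

section \<open>The induction for the lower bound\<close>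

lemma T_power_ge: "n \<ge> 5 \<Longrightarrow> 15 ^ n \<le> T n ^ 5"
proof (induction n rule: less_induct)
  case (less n)
  have base: "15 ^ k \<le> T k ^ 5" if "c \<le> T k" "15 ^ k \<le> c ^ 5" for c k
    using power_mono[OF that(1), of 5] that(2) by linarith
  show ?case
  proof (cases "n \<le> 19")
    case True
    have T15: "3 * 15 ^ 3 \<le> T 15" using T_triple[of 5] power_mono[OF T_5_ge, of 3] by simp
    have T16: "16384 \<le> T 16" using T_klein_ge[of 4 0 0] T_0_ge by simp
    have T17: "12288 \<le> T 17" using T_klein_ge[of 3 1 1] T_1_ge by simp
    have T18: "3 * 32 ^ 3 \<le> T 18" using T_triple[of 6] power_mono[OF T_6_ge, of 3] by simp
    have "n \<in> {5, 6, 7, 8, 9, 10, 11, 12, 13, 14, 15, 16, 17, 18, 19}" using True less.prems by (cases "n \<le> 12") auto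
    then show ?thesis
      by (elim insertE emptyE; simp only:)
        (rule base, rule T_5_ge T_6_ge T_7_ge T_8_ge T_ge_from_9 T_ge_from_11 T_ge_from_13
          T15 T16 T17 T18 T_19_ge, simp)+
  next
    case False
    \<comment> \<open>A given odd \<open>m\<close> covers
      \<open>3 * m + 5 \<le> n \<le> 5 * m\<close>: 20 to 25 for \<open>m = 5\<close> and 26 to 35
      for \<open>m = 7\<close>.\<close>
    have "\<exists>m t. n = 3 * m + t \<and> odd m \<and> 5 \<le> m \<and> 5 \<le> t \<and> t \<le> 2 * m"
    proof -
      consider "n \<le> 25" | "25 < n" "n < 32" | "32 \<le> n" using False by linarith
      then show ?thesis
      proof cases
        case 1
        then show ?thesis using False by (intro exI[of _ 5] exI[of _ "n - 15"]) auto
      next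
        case 2
        then show ?thesis by (intro exI[of _ 7] exI[of _ "n - 21"]) auto
      next
        case 3
        define q where "q = n div 8"
        \<comment> \<open>For \<open>m = 2 * q + 1\<close> the covered range is
          \<open>6 * q + 8\<close> to \<open>10 * q + 5\<close>, which contains \<open>8 * q\<close>
          to \<open>8 * q + 7\<close> once \<open>q \<ge> 4\<close>.\<close>
        have q: "4 \<le> q" "8 * q \<le> n" "n < 8 * q + 8" using 3 unfolding q_def by linarith+
        then show ?thesis by (intro exI[of _ "2 * q + 1"] exI[of _ "n - (6 * q + 3)"]) auto
      qed
    qed
    then obtain m t where mt: "n = 3 * m + t" "odd m" "5 \<le> m" "5 \<le> t" "t \<le> 2 * m" by blast
    have "15 ^ n = (15 ^ m) ^ 3 * (15 :: nat) ^ t"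
      unfolding mt(1) by (simp add: power_add power_mult mult.commute)
    also have "\<dots> \<le> (T m ^ 5) ^ 3 * T t ^ 5"
      using mt by (intro mult_le_mono power_mono less.IH) auto
    also have "\<dots> = (T m ^ 3 * T t) ^ 5"
      by (simp add: power_mult_distrib flip: power_mult)
    also have "\<dots> \<le> T n ^ 5"
      using T_triple_add[OF mt(2,5)] unfolding mt(1) by (intro power_mono) auto
    finally show ?thesis .
  qed
qed

lemma T_lower:
  assumes "n \<ge> 5"
  shows "15 powr (real n / 5) \<le> real (T n)"
proof -
  have "(15 powr (real n / 5)) ^ 5 = 15 ^ n"
    by (simp add: powr_realpow[symmetric] powr_powr)
  also have "\<dots> \<le> real (T n) ^ 5"
    using T_power_ge[OF assms] by (metis of_nat_le_iff of_nat_numeral of_nat_power)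
  finally have "(15 powr (real n / 5)) ^ Suc 4 \<le> real (T n) ^ Suc 4" by simp
  then show ?thesis by (rule power_le_imp_le_base) simp
qed

theorem theorem3p1:
  fixes n :: nat
  assumes "n \<ge> 5"
  shows "(15::real) powr (real n / 5) \<le> real (T n) \<and>
         real (T n) \<le> (sqrt ((3 - sqrt 3) / 6) * exp (sqrt 3 / 6)) ^ n * sqrt (real n) * fact n"
  using T_lower[OF assms] T_upper[OF assms] unfolding transversal_base_def by simp

end
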